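(* Let $q\ge 2$ be an integer, let $\mathcal{T}_{q+1}=(V,E)$ be the $(q+1)$-regular tree with graph distance $d$, and let $G$ be a closed non-compact subgroup of $\mathrm{Aut}(\mathcal{T}_{q+1})$ acting transitively on the vertices and on the boundary $\partial\mathcal{T}_{q+1}$. (i) Suppose $G$ acts by affine isometries on a Hilbert space $\mathcal{H}$. Then any $G$-equivariant map $F:V\to\mathcal{H}$ such that $F(x_0)=0$ for some $x_0\in V$ satisfies, for all $x\in V$, $$\|F(x)\|^2\le A\,d(x,x_0)-B+B\,q^{-d(x,x_0)},$$ where $$A=\frac{(q+1)\|F(x_1)\|^2}{q-1},\qquad B=\frac{2q\|F(x_1)\|^2}{(q-1)^2},$$ and $x_1$ is any vertex adjacent to $x_0$. (ii) If, furthermore, the map $F$ in (i) is harmonic and non-constant, then equality holds in (i), i.e. $\|F(x)\|^2=A\,d(x,x_0)-B+B\,q^{-d(x,x_0)}$ for all $x\in V$. (iii) There exist a Hilbert space $\mathcal{H}$, an action of $G$ on $\mathcal{H}$ by affine isometries, and a $G$-equivariant map $F:V\to\mathcal{H}$ which is harmonic and non-constant.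
   Context: $\mathrm{Aut}(\mathcal{T}_{q+1})$ carries the topology of pointwise convergence on vertices (so vertex stabilisers are compact and open), and $\partial\mathcal{T}_{q+1}$ is the space of ends of the tree. An action of $G$ by affine isometries on $\mathcal{H}$ is an action of the form $\alpha(g)v=\pi(g)v+b(g)$, where $\pi$ is a continuous unitary representation of $G$ on $\mathcal{H}$ and $b:G\to\mathcal{H}$ is a continuous map with $b(gh)=\pi(g)b(h)+b(g)$ for all $g,h\in G$. A map $F:V\to\mathcal{H}$ is $G$-equivariant if $F(gx)=\alpha(g)F(x)$ for all $g\in G$, $x\in V$. The Laplace operator is $\mathcal{L}F(x)=\left(\frac{1}{q+1}\sum_{y\sim x}F(y)\right)-F(x)$, and $F$ is harmonic if $\mathcal{L}F\equiv 0$. *)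

theory Defs
  imports "HOL-Analysis.Analysis" "HOL-Algebra.Group"
begin

section \<open>Complex Hilbert spaces\<close>

class complex_inner = real_inner +
  fixes scaleC :: "complex \<Rightarrow> 'a \<Rightarrow> 'a"  (infixr \<open>*\<^sub>C\<close> 75)
    and cinner :: "'a \<Rightarrow> 'a \<Rightarrow> complex"
  assumes scaleC_add_right: "c *\<^sub>C (x + y) = c *\<^sub>C x + c *\<^sub>C y"
    and scaleC_add_left: "(c + d) *\<^sub>C x = c *\<^sub>C x + d *\<^sub>C x"
    and scaleC_scaleC: "c *\<^sub>C d *\<^sub>C x = (c * d) *\<^sub>C x"
    and scaleR_scaleC: "r *\<^sub>R x = complex_of_real r *\<^sub>C x"
    and cinner_add_left: "cinner (x + y) z = cinner x z + cinner y z"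
    and cinner_scaleC_left: "cinner (c *\<^sub>C x) y = c * cinner x y"
    and cinner_commute: "cinner y x = cnj (cinner x y)"
    and inner_Re_cinner: "inner x y = Re (cinner x y)"

text \<open>Positivity of \<open>cinner\<close>, and \<open>norm x ^ 2 = Re (cinner x x)\<close>, come from \<open>real_inner\<close>
  through \<open>inner_Re_cinner\<close>.\<close>

class complex_hilbert_space = complex_inner + complete_space


subsection \<open>The sequence space \<open>\<ell>\<^sup>2\<close>\<close>

typedef ell2 = "{f :: nat \<Rightarrow> complex. summable (\<lambda>n. (cmod (f n))\<^sup>2)}"
  morphisms ell2_nth Abs_ell2
  by (intro exI[of _ "\<lambda>_. 0"]) simp

setup_lifting type_definition_ell2

lemma summable_ell2_nth: "summable (\<lambda>n. (cmod (ell2_nth x n))\<^sup>2)"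
  using ell2_nth[of x] by simp

lemma ell2_eqI: "(\<And>n. ell2_nth x n = ell2_nth y n) \<Longrightarrow> x = y"
  by (metis ell2_nth_inject ext)

lemma summable_sq_add:
  fixes f g :: "nat \<Rightarrow> complex"
  assumes "summable (\<lambda>n. (cmod (f n))\<^sup>2)" "summable (\<lambda>n. (cmod (g n))\<^sup>2)"
  shows "summable (\<lambda>n. (cmod (f n + g n))\<^sup>2)"
proof (rule summable_comparison_test')
  show "summable (\<lambda>n. 2 * (cmod (f n))\<^sup>2 + 2 * (cmod (g n))\<^sup>2)"
    using assms by (intro summable_add summable_mult)
next
  fix n :: nat
  have "(cmod (f n + g n))\<^sup>2 \<le> (cmod (f n) + cmod (g n))\<^sup>2"
    by (intro power_mono norm_triangle_ineq norm_ge_zero)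
  also have "\<dots> \<le> 2 * (cmod (f n))\<^sup>2 + 2 * (cmod (g n))\<^sup>2"
    using sum_squares_bound[of "cmod (f n)" "cmod (g n)"] by (simp add: power2_sum)
  finally show "norm ((cmod (f n + g n))\<^sup>2) \<le> 2 * (cmod (f n))\<^sup>2 + 2 * (cmod (g n))\<^sup>2"
    by simp
qed

lemma summable_sq_scale:
  fixes f :: "nat \<Rightarrow> complex"
  assumes "summable (\<lambda>n. (cmod (f n))\<^sup>2)"
  shows "summable (\<lambda>n. (cmod (c * f n))\<^sup>2)"
  using summable_mult[OF assms, of "(cmod c)\<^sup>2"] by (simp add: norm_mult power_mult_distrib)

lemma summable_sq_diff:
  fixes f g :: "nat \<Rightarrow> complex"
  assumes "summable (\<lambda>n. (cmod (f n))\<^sup>2)" "summable (\<lambda>n. (cmod (g n))\<^sup>2)"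
  shows "summable (\<lambda>n. (cmod (f n - g n))\<^sup>2)"
  using summable_sq_add[OF assms(1) summable_sq_scale[OF assms(2), of "-1"]] by simp

lemma summable_ell2_mult: "summable (\<lambda>n. ell2_nth x n * cnj (ell2_nth y n))"
proof (rule summable_comparison_test')
  show "summable (\<lambda>n. (cmod (ell2_nth x n))\<^sup>2 + (cmod (ell2_nth y n))\<^sup>2)"
    by (intro summable_add summable_ell2_nth)
next
  fix n :: nat
  have "cmod (ell2_nth x n) * cmod (ell2_nth y n)
      \<le> 2 * (cmod (ell2_nth x n) * cmod (ell2_nth y n))" by simp
  also have "\<dots> \<le> (cmod (ell2_nth x n))\<^sup>2 + (cmod (ell2_nth y n))\<^sup>2"
    using sum_squares_bound[of "cmod (ell2_nth x n)" "cmod (ell2_nth y n)"] by simp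
  finally show "cmod (ell2_nth x n * cnj (ell2_nth y n))
      \<le> (cmod (ell2_nth x n))\<^sup>2 + (cmod (ell2_nth y n))\<^sup>2"
    by (simp add: norm_mult)
qed

instantiation ell2 :: complex_inner
begin

lift_definition zero_ell2 :: ell2 is "\<lambda>_. 0" by simp
lift_definition plus_ell2 :: "ell2 \<Rightarrow> ell2 \<Rightarrow> ell2" is "\<lambda>f g n. f n + g n"
  by (rule summable_sq_add)
lift_definition minus_ell2 :: "ell2 \<Rightarrow> ell2 \<Rightarrow> ell2" is "\<lambda>f g n. f n - g n"
  by (rule summable_sq_diff)
lift_definition uminus_ell2 :: "ell2 \<Rightarrow> ell2" is "\<lambda>f n. - f n" by simp
lift_definition scaleC_ell2 :: "complex \<Rightarrow> ell2 \<Rightarrow> ell2" is "\<lambda>c f n. c * f n"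
  by (rule summable_sq_scale)
lift_definition cinner_ell2 :: "ell2 \<Rightarrow> ell2 \<Rightarrow> complex"
  is "\<lambda>f g. \<Sum>n. f n * cnj (g n)" .

definition scaleR_ell2 :: "real \<Rightarrow> ell2 \<Rightarrow> ell2"
  where "scaleR_ell2 r x = complex_of_real r *\<^sub>C x"
definition inner_ell2 :: "ell2 \<Rightarrow> ell2 \<Rightarrow> real"
  where "inner_ell2 x y = Re (cinner x y)"
definition norm_ell2 :: "ell2 \<Rightarrow> real"
  where "norm_ell2 x = sqrt (inner x x)"
definition dist_ell2 :: "ell2 \<Rightarrow> ell2 \<Rightarrow> real"
  where "dist_ell2 x y = norm (x - y)"
definition sgn_ell2 :: "ell2 \<Rightarrow> ell2"
  where "sgn_ell2 x = inverse (norm x) *\<^sub>R x"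
definition uniformity_ell2 :: "(ell2 \<times> ell2) filter"
  where "uniformity_ell2 = (INF e\<in>{0<..}. principal {(x, y). dist x y < e})"
definition open_ell2 :: "ell2 set \<Rightarrow> bool"
  where "open_ell2 U \<longleftrightarrow> (\<forall>x\<in>U. \<forall>\<^sub>F (x', y) in uniformity. x' = x \<longrightarrow> y \<in> U)"

lemmas ell2_nth_simps = zero_ell2.rep_eq plus_ell2.rep_eq minus_ell2.rep_eq
  uminus_ell2.rep_eq scaleC_ell2.rep_eq

lemma inner_ell2_self: "inner x x = (\<Sum>n. (cmod (ell2_nth x n))\<^sup>2)" for x :: ell2
proof -
  have "Re (\<Sum>n. ell2_nth x n * cnj (ell2_nth x n))
      = (\<Sum>n. Re (ell2_nth x n * cnj (ell2_nth x n)))"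
    by (rule bounded_linear.suminf[OF bounded_linear_Re summable_ell2_mult])
  also have "\<dots> = (\<Sum>n. (cmod (ell2_nth x n))\<^sup>2)"
    by (simp add: complex_mult_cnj cmod_power2)
  finally show ?thesis by (simp add: inner_ell2_def cinner_ell2.rep_eq)
qed

lemma cinner_ell2_add: "cinner (x + y) z = cinner x z + cinner y z" for x y z :: ell2
  by (simp add: cinner_ell2.rep_eq ell2_nth_simps distrib_right suminf_add summable_ell2_mult)

lemma cinner_ell2_scale: "cinner (c *\<^sub>C x) y = c * cinner x y" for x y :: ell2
  by (simp add: cinner_ell2.rep_eq ell2_nth_simps mult.assoc suminf_mult summable_ell2_mult)

lemma cinner_ell2_commute: "cinner y x = cnj (cinner x y)" for x y :: ell2
proof -
  have "cnj (\<Sum>n. ell2_nth x n * cnj (ell2_nth y n))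
      = (\<Sum>n. cnj (ell2_nth x n * cnj (ell2_nth y n)))"
    by (rule bounded_linear.suminf[OF bounded_linear_cnj summable_ell2_mult])
  then show ?thesis by (simp add: cinner_ell2.rep_eq mult.commute)
qed

instance
proof
  fix x y z :: ell2 and a b :: real and c d :: complex
  show "x + y + z = x + (y + z)" "x + y = y + x" "0 + x = x" "- x + x = 0" "x - y = x + - y"
    by (rule ell2_eqI; simp add: ell2_nth_simps)+
  show "a *\<^sub>R (x + y) = a *\<^sub>R x + a *\<^sub>R y" "(a + b) *\<^sub>R x = a *\<^sub>R x + b *\<^sub>R x"
    "a *\<^sub>R b *\<^sub>R x = (a * b) *\<^sub>R x" "1 *\<^sub>R x = x"
    by (rule ell2_eqI; simp add: scaleR_ell2_def ell2_nth_simps algebra_simps)+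
  show "c *\<^sub>C (x + y) = c *\<^sub>C x + c *\<^sub>C y" "(c + d) *\<^sub>C x = c *\<^sub>C x + d *\<^sub>C x"
    "c *\<^sub>C d *\<^sub>C x = (c * d) *\<^sub>C x"
    by (rule ell2_eqI; simp add: ell2_nth_simps algebra_simps)+
  show "inner x y = inner y x"
    using cinner_ell2_commute[of x y] by (simp add: inner_ell2_def)
  show "inner (x + y) z = inner x z + inner y z"
    by (simp add: inner_ell2_def cinner_ell2_add)
  show "inner (a *\<^sub>R x) y = a * inner x y"
    by (simp add: inner_ell2_def scaleR_ell2_def cinner_ell2_scale)
  show "0 \<le> inner x x"
    by (simp add: inner_ell2_self suminf_nonneg summable_ell2_nth)
  show "inner x x = 0 \<longleftrightarrow> x = 0"
    by (auto simp: inner_ell2_self suminf_eq_zero_iff summable_ell2_nth zero_ell2.rep_eq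
        intro: ell2_eqI)
  show "dist x y = norm (x - y)" by (rule dist_ell2_def)
  show "sgn x = inverse (norm x) *\<^sub>R x" by (rule sgn_ell2_def)
  show "norm x = sqrt (inner x x)" by (rule norm_ell2_def)
  show "a *\<^sub>R x = complex_of_real a *\<^sub>C x" by (rule scaleR_ell2_def)
  show "inner x y = Re (cinner x y)" by (rule inner_ell2_def)
  show "cinner (x + y) z = cinner x z + cinner y z" by (rule cinner_ell2_add)
  show "cinner (c *\<^sub>C x) y = c * cinner x y" by (rule cinner_ell2_scale)
  show "cinner y x = cnj (cinner x y)" by (rule cinner_ell2_commute)
next
  show "uniformity = (INF e\<in>{0<..}. principal {(x :: ell2, y). dist x y < e})"
    by (rule uniformity_ell2_def)
next
  fix U :: "ell2 set"
  show "open U \<longleftrightarrow> (\<forall>x\<in>U. \<forall>\<^sub>F (x', y) in uniformity. x' = x \<longrightarrow> y \<in> U)"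
    by (rule open_ell2_def)
qed

end

lemma norm_ell2_power2: "(norm x)\<^sup>2 = (\<Sum>n. (cmod (ell2_nth x n))\<^sup>2)" for x :: ell2
  by (simp add: power2_norm_eq_inner inner_ell2_self)

lemma sum_le_norm_ell2: "(\<Sum>k<N. (cmod (ell2_nth x k))\<^sup>2) \<le> (norm x)\<^sup>2"
  unfolding norm_ell2_power2 by (intro sum_le_suminf summable_ell2_nth) auto

lemma cmod_le_norm_ell2: "cmod (ell2_nth x k) \<le> norm x"
proof (rule power2_le_imp_le)
  have "(cmod (ell2_nth x k))\<^sup>2 \<le> (\<Sum>i<Suc k. (cmod (ell2_nth x i))\<^sup>2)"
    by (simp add: sum_nonneg)
  also have "\<dots> \<le> (norm x)\<^sup>2" by (rule sum_le_norm_ell2)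
  finally show "(cmod (ell2_nth x k))\<^sup>2 \<le> (norm x)\<^sup>2" .
qed simp

instance ell2 :: complex_hilbert_space
proof
  fix X :: "nat \<Rightarrow> ell2"
  assume X: "Cauchy X"
  have "Cauchy (\<lambda>n. ell2_nth (X n) k)" for k
  proof (rule CauchyI)
    fix e :: real assume "0 < e"
    then obtain M where M: "\<And>m n. m \<ge> M \<Longrightarrow> n \<ge> M \<Longrightarrow> norm (X m - X n) < e"
      using CauchyD[OF X] by blast
    have "cmod (ell2_nth (X m) k - ell2_nth (X n) k) < e" if "m \<ge> M" "n \<ge> M" for m n
      using cmod_le_norm_ell2[of "X m - X n" k] M[OF that] by (simp add: ell2_nth_simps)
    then show "\<exists>M. \<forall>m\<ge>M. \<forall>n\<ge>M. norm (ell2_nth (X m) k - ell2_nth (X n) k) < e" by blast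
  qed
  then have lims: "(\<lambda>n. ell2_nth (X n) k) \<longlonglongrightarrow> lim (\<lambda>n. ell2_nth (X n) k)" for k
    using Cauchy_convergent convergent_LIMSEQ_iff by blast
  define L where "L k = lim (\<lambda>n. ell2_nth (X n) k)" for k
  have L: "(\<lambda>n. ell2_nth (X n) k) \<longlonglongrightarrow> L k" for k
    unfolding L_def by (rule lims)
  have part: "(\<Sum>k<N. (cmod (ell2_nth (X m) k - L k))\<^sup>2) \<le> e\<^sup>2"
    if e: "0 < e" and M: "\<And>n. n \<ge> M \<Longrightarrow> norm (X m - X n) < e" for e m M N
  proof (rule LIMSEQ_le_const2)
    show "(\<lambda>n. \<Sum>k<N. (cmod (ell2_nth (X m) k - ell2_nth (X n) k))\<^sup>2)
        \<longlonglongrightarrow> (\<Sum>k<N. (cmod (ell2_nth (X m) k - L k))\<^sup>2)"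
      by (intro tendsto_intros L)
    have "(\<Sum>k<N. (cmod (ell2_nth (X m) k - ell2_nth (X n) k))\<^sup>2) \<le> e\<^sup>2" if "n \<ge> M" for n
    proof -
      have "(\<Sum>k<N. (cmod (ell2_nth (X m) k - ell2_nth (X n) k))\<^sup>2) \<le> (norm (X m - X n))\<^sup>2"
        using sum_le_norm_ell2[of "X m - X n" N] by (simp add: ell2_nth_simps)
      also have "\<dots> \<le> e\<^sup>2" using M[OF that] by (intro power_mono) auto
      finally show ?thesis .
    qed
    then show "\<exists>N'. \<forall>n\<ge>N'. (\<Sum>k<N. (cmod (ell2_nth (X m) k - ell2_nth (X n) k))\<^sup>2) \<le> e\<^sup>2"
      by blast
  qed
  have diff: "summable (\<lambda>k. (cmod (ell2_nth (X m) k - L k))\<^sup>2)"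
    if "0 < e" and "\<And>n. n \<ge> M \<Longrightarrow> norm (X m - X n) < e" for e m M
    by (rule summableI_nonneg_bounded[OF _ part[OF that]]) auto
  obtain M1 where M1: "\<And>m n. m \<ge> M1 \<Longrightarrow> n \<ge> M1 \<Longrightarrow> norm (X m - X n) < 1"
    using CauchyD[OF X, of 1] by auto
  have "summable (\<lambda>k. (cmod (ell2_nth (X M1) k - L k))\<^sup>2)"
    using diff[of 1 M1 M1] M1 by simp
  from summable_sq_diff[OF summable_ell2_nth[of "X M1"] this]
  have "summable (\<lambda>k. (cmod (L k))\<^sup>2)" by simp
  then have nthL: "ell2_nth (Abs_ell2 L) = L" by (simp add: Abs_ell2_inverse)
  have "X \<longlonglongrightarrow> Abs_ell2 L"
  proof (rule LIMSEQ_I)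
    fix r :: real assume r: "0 < r"
    then obtain M where M: "\<And>m n. m \<ge> M \<Longrightarrow> n \<ge> M \<Longrightarrow> norm (X m - X n) < r / 2"
      using CauchyD[OF X, of "r / 2"] by auto
    have "norm (X m - Abs_ell2 L) < r" if m: "m \<ge> M" for m
    proof -
      have "(norm (X m - Abs_ell2 L))\<^sup>2 = (\<Sum>k. (cmod (ell2_nth (X m) k - L k))\<^sup>2)"
        by (simp add: norm_ell2_power2 ell2_nth_simps nthL)
      also have "\<dots> \<le> (r / 2)\<^sup>2"
        by (rule suminf_le_const[OF diff[of "r / 2" M m] part[of "r / 2" M m]]; use r M m in simp)
      finally have "norm (X m - Abs_ell2 L) \<le> r / 2"
        by (rule power2_le_imp_le) (use r in simp)
      then show ?thesis using r by simp
    qed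
    then show "\<exists>no. \<forall>n\<ge>no. norm (X n - Abs_ell2 L) < r" by blast
  qed
  then show "convergent X" by (auto simp: convergent_def)
qed


section \<open>Regular trees and their automorphisms\<close>

text \<open>A graph is given by its adjacency relation; the vertex set is the whole type.\<close>

definition simple_graph :: "('v \<Rightarrow> 'v \<Rightarrow> bool) \<Rightarrow> bool"
  where "simple_graph adj \<longleftrightarrow> symp adj \<and> irreflp adj"

definition graph_connected :: "('v \<Rightarrow> 'v \<Rightarrow> bool) \<Rightarrow> bool"
  where "graph_connected adj \<longleftrightarrow> (\<forall>x y. adj\<^sup>*\<^sup>* x y)"

definition graph_cycle :: "('v \<Rightarrow> 'v \<Rightarrow> bool) \<Rightarrow> 'v list \<Rightarrow> bool"
  where "graph_cycle adj xs \<longleftrightarrow>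
    length xs \<ge> 3 \<and> distinct xs \<and> successively adj xs \<and> adj (last xs) (hd xs)"

definition graph_tree :: "('v \<Rightarrow> 'v \<Rightarrow> bool) \<Rightarrow> bool"
  where "graph_tree adj \<longleftrightarrow>
    simple_graph adj \<and> graph_connected adj \<and> (\<nexists>xs. graph_cycle adj xs)"

definition regular_tree :: "nat \<Rightarrow> ('v \<Rightarrow> 'v \<Rightarrow> bool) \<Rightarrow> bool"
  where "regular_tree k adj \<longleftrightarrow>
    graph_tree adj \<and> (\<forall>x. finite {y. adj x y} \<and> card {y. adj x y} = k)"

definition graph_dist :: "('v \<Rightarrow> 'v \<Rightarrow> bool) \<Rightarrow> 'v \<Rightarrow> 'v \<Rightarrow> nat"
  where "graph_dist adj x y = (LEAST n. (adj ^^ n) x y)"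

definition graph_aut :: "('v \<Rightarrow> 'v \<Rightarrow> bool) \<Rightarrow> ('v \<Rightarrow> 'v) set"
  where "graph_aut adj = {g. bij g \<and> (\<forall>x y. adj (g x) (g y) \<longleftrightarrow> adj x y)}"

definition aut_group :: "('v \<Rightarrow> 'v \<Rightarrow> bool) \<Rightarrow> ('v \<Rightarrow> 'v) monoid"
  where "aut_group adj = \<lparr>carrier = graph_aut adj, mult = (\<circ>), one = id\<rparr>"

lemma group_aut_group: "group (aut_group adj)"
proof (rule groupI)
  fix g assume "g \<in> carrier (aut_group adj)"
  then have g: "bij g" "\<And>x y. adj (g x) (g y) \<longleftrightarrow> adj x y"
    by (auto simp: aut_group_def graph_aut_def)
  have "adj (inv_into UNIV g x) (inv_into UNIV g y) \<longleftrightarrow> adj x y" for x y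
    using g(2)[of "inv_into UNIV g x" "inv_into UNIV g y"] g(1)
    by (simp add: bij_is_surj surj_f_inv_f)
  with g(1) have "inv_into UNIV g \<in> carrier (aut_group adj)"
    by (simp add: aut_group_def graph_aut_def bij_imp_bij_inv)
  moreover have "inv_into UNIV g \<circ> g = id"
    using g(1) by (simp add: bij_is_inj)
  ultimately show "\<exists>h\<in>carrier (aut_group adj). h \<otimes>\<^bsub>aut_group adj\<^esub> g = \<one>\<^bsub>aut_group adj\<^esub>"
    by (auto simp: aut_group_def)
qed (auto simp: aut_group_def graph_aut_def bij_comp comp_assoc)

text \<open>Pointwise convergence on vertices, the vertex set being discrete.\<close>

definition aut_topology :: "('v \<Rightarrow> 'v \<Rightarrow> bool) \<Rightarrow> ('v \<Rightarrow> 'v) topology"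
  where "aut_topology adj =
    subtopology (product_topology (\<lambda>_. discrete_topology UNIV) UNIV) (graph_aut adj)"


subsection \<open>Ends\<close>

definition rays :: "('v \<Rightarrow> 'v \<Rightarrow> bool) \<Rightarrow> (nat \<Rightarrow> 'v) set"
  where "rays adj = {r. inj r \<and> (\<forall>n. adj (r n) (r (Suc n)))}"

definition ray_equiv :: "('v \<Rightarrow> 'v \<Rightarrow> bool) \<Rightarrow> ((nat \<Rightarrow> 'v) \<times> (nat \<Rightarrow> 'v)) set"
  where "ray_equiv adj =
    {(r, s). r \<in> rays adj \<and> s \<in> rays adj \<and> (\<exists>m n. \<forall>k. r (m + k) = s (n + k))}"

text \<open>In a tree two rays define the same end iff they have a common tail.\<close>

definition tree_ends :: "('v \<Rightarrow> 'v \<Rightarrow> bool) \<Rightarrow> (nat \<Rightarrow> 'v) set set"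
  where "tree_ends adj = rays adj // ray_equiv adj"

definition end_action :: "('v \<Rightarrow> 'v) \<Rightarrow> (nat \<Rightarrow> 'v) set \<Rightarrow> (nat \<Rightarrow> 'v) set"
  where "end_action g \<xi> = (\<lambda>r. g \<circ> r) ` \<xi>"

definition vertex_transitive :: "('v \<Rightarrow> 'v) set \<Rightarrow> bool"
  where "vertex_transitive G \<longleftrightarrow> (\<forall>x y. \<exists>g\<in>G. g x = y)"

definition boundary_transitive :: "('v \<Rightarrow> 'v \<Rightarrow> bool) \<Rightarrow> ('v \<Rightarrow> 'v) set \<Rightarrow> bool"
  where "boundary_transitive adj G \<longleftrightarrow>
    (\<forall>\<xi>\<in>tree_ends adj. \<forall>\<eta>\<in>tree_ends adj. \<exists>g\<in>G. end_action g \<xi> = \<eta>)"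


section \<open>Affine isometric actions, equivariance and harmonicity\<close>

definition unitary_map :: "('h::complex_inner \<Rightarrow> 'h) \<Rightarrow> bool"
  where "unitary_map U \<longleftrightarrow>
    (\<forall>v w. U (v + w) = U v + U w) \<and> (\<forall>c v. U (c *\<^sub>C v) = c *\<^sub>C U v) \<and>
    (\<forall>v w. cinner (U v) (U w) = cinner v w) \<and> surj U"

text \<open>Continuity of a representation is strong continuity.  Since \<open>\<pi> (g \<circ> h) = \<pi> g \<circ> \<pi> h\<close> and
  the operators are bijective, \<open>\<pi> id\<close> is the identity.\<close>

definition unitary_rep ::
    "('v \<Rightarrow> 'v \<Rightarrow> bool) \<Rightarrow> ('v \<Rightarrow> 'v) set \<Rightarrow> (('v \<Rightarrow> 'v) \<Rightarrow> 'h \<Rightarrow> 'h::complex_hilbert_space) \<Rightarrow> bool"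
  where "unitary_rep adj G \<pi> \<longleftrightarrow>
    (\<forall>g\<in>G. unitary_map (\<pi> g)) \<and>
    (\<forall>g\<in>G. \<forall>h\<in>G. \<forall>v. \<pi> (g \<circ> h) v = \<pi> g (\<pi> h v)) \<and>
    (\<forall>v. continuous_map (subtopology (aut_topology adj) G) euclidean (\<lambda>g. \<pi> g v))"

definition cocycle ::
    "('v \<Rightarrow> 'v \<Rightarrow> bool) \<Rightarrow> ('v \<Rightarrow> 'v) set \<Rightarrow> (('v \<Rightarrow> 'v) \<Rightarrow> 'h \<Rightarrow> 'h)
      \<Rightarrow> (('v \<Rightarrow> 'v) \<Rightarrow> 'h::complex_hilbert_space) \<Rightarrow> bool"
  where "cocycle adj G \<pi> b \<longleftrightarrow>
    continuous_map (subtopology (aut_topology adj) G) euclidean b \<and>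
    (\<forall>g\<in>G. \<forall>h\<in>G. b (g \<circ> h) = \<pi> g (b h) + b g)"

definition affine_isometric_action ::
    "('v \<Rightarrow> 'v \<Rightarrow> bool) \<Rightarrow> ('v \<Rightarrow> 'v) set \<Rightarrow> (('v \<Rightarrow> 'v) \<Rightarrow> 'h \<Rightarrow> 'h::complex_hilbert_space) \<Rightarrow> bool"
  where "affine_isometric_action adj G \<alpha> \<longleftrightarrow>
    (\<exists>\<pi> b. unitary_rep adj G \<pi> \<and> cocycle adj G \<pi> b \<and> (\<forall>g\<in>G. \<forall>v. \<alpha> g v = \<pi> g v + b g))"

definition equivariant :: "('v \<Rightarrow> 'v) set \<Rightarrow> (('v \<Rightarrow> 'v) \<Rightarrow> 'h \<Rightarrow> 'h) \<Rightarrow> ('v \<Rightarrow> 'h) \<Rightarrow> bool"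
  where "equivariant G \<alpha> F \<longleftrightarrow> (\<forall>g\<in>G. \<forall>x. F (g x) = \<alpha> g (F x))"

definition laplace ::
    "nat \<Rightarrow> ('v \<Rightarrow> 'v \<Rightarrow> bool) \<Rightarrow> ('v \<Rightarrow> 'h) \<Rightarrow> 'v \<Rightarrow> 'h::real_vector"
  where "laplace q adj F x = (1 / (real q + 1)) *\<^sub>R (\<Sum>y | adj x y. F y) - F x"

definition harmonic :: "nat \<Rightarrow> ('v \<Rightarrow> 'v \<Rightarrow> bool) \<Rightarrow> ('v \<Rightarrow> 'h::real_vector) \<Rightarrow> bool"
  where "harmonic q adj F \<longleftrightarrow> (\<forall>x. laplace q adj F x = 0)"

end

theory Submission
  imports Defs
begin

text \<open>
  Three ideas carry the proof.

  \<^emph>\<open>Distance transitivity.\<close> Transitivity on vertices and ends forces the group to be transitive on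
  pairs of vertices at equal distance (\<open>distance_transitive\<close>). Call an oriented edge transitive if
  its stabiliser is transitive on every level of the half-tree it points into. If no edge were, a
  diagonal construction over the countable vertex set would give a ray whose end lies outside the
  orbit of a given end (\<open>halftree_transitive_exists\<close>): two elements sending a base point to the same vertex
  \<open>v\<close> differ by an element fixing \<open>v\<close>, so they cannot carry the given end behind two vertices that
  lie in a half-tree without \<open>v\<close> and that the stabiliser of its edge does not map to one another.
  This transitivity is inherited by all edges further on. Since the group moves every vertex to
  every other, each vertex then has at most one outgoing edge without it, and such an edge would
  give an equivariant parent map whose iterates lead to an end fixed by the group. So all edges
  are transitive, and for two vertices at equal distance from \<open>x\<close>, the stabiliser of an edge at
  \<open>x\<close> that leads to neither of them maps one to the other.

  \<^emph>\<open>The bound.\<close> For an equivariant \<open>F\<close>, the number \<open>\<parallel>F x - F y\<parallel>\<^sup>2\<close> is therefore a function \<open>a\<close> of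
  \<open>d x y\<close>. Let \<open>M\<close> be the average over neighbours. Averaging a radial kernel in its first or in
  its second variable gives the same radial kernel, so the inner product of \<open>M\<^sup>jF x - M\<^sup>jF y\<close> with
  \<open>M\<^sup>kF x - M\<^sup>kF y\<close> depends on \<open>j + k\<close> only. By Cauchy-Schwarz the norms \<open>s k\<close> of \<open>M\<^sup>kF x - M\<^sup>kF
  y\<close> satisfy \<open>(s (k+1))\<^sup>2 \<le> s k * s (k+2)\<close>. They grow at most linearly, because each application
  of \<open>M\<close> moves every value by at most \<open>sqrt (a 1)\<close>. A log-convex sequence of linear growth cannot
  start by increasing, hence \<open>\<parallel>MF x - MF y\<parallel> \<le> \<parallel>F x - F y\<parallel>\<close> (\<open>nbr_avg_contracts\<close>). In terms of \<open>a\<close>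
  this says \<open>q a(n+2) + a(n) \<le> (q+1) (a(n+1) + a(1))\<close>, with equality when \<open>MF = F\<close>. The function
  in the theorem solves the equation with the same values at \<open>0\<close> and \<open>1\<close>, and comparing increments
  gives both the inequality and, for harmonic \<open>F\<close>, the equality.

  \<^emph>\<open>Existence.\<close> The probability that simple random walk started at \<open>x\<close> ends in the half-tree
  behind an oriented edge \<open>e\<close> is a harmonic function \<open>h\<^sub>e\<close> of \<open>x\<close>. It varies by an amount of order
  \<open>q\<^sup>-\<^sup>k\<close> between neighbouring \<open>x\<close> at distance \<open>k\<close> from \<open>e\<close>. There are at most \<open>(q+1)\<^sup>k\<^sup>+\<^sup>1\<close> edges
  starting at distance \<open>k\<close>, and \<open>q + 1 < q\<^sup>2\<close>, so \<open>F x = (h\<^sub>e(x) - h\<^sub>e(x\<^sub>0))\<^sub>e\<close> is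
  square-summable. The group permutes the edges, and \<open>F\<close> is equivariant for this permutation
  representation with the cocycle \<open>g \<mapsto> F (g x\<^sub>0)\<close> (\<open>harmonic_equivariant_exists\<close>).
\<close>

section \<open>Geodesics in trees\<close>

locale tree_graph =
  fixes adj :: "'v \<Rightarrow> 'v \<Rightarrow> bool"
  assumes tree: "graph_tree adj"
begin

abbreviation d :: "'v \<Rightarrow> 'v \<Rightarrow> nat"
  where "d \<equiv> graph_dist adj"

lemma adj_sym: "adj x y \<Longrightarrow> adj y x"
  using tree by (auto simp: graph_tree_def simple_graph_def symp_def)

lemma adj_irrefl: "\<not> adj x x"
  using tree by (auto simp: graph_tree_def simple_graph_def irreflp_def)

lemma no_cycle: "\<not> graph_cycle adj xs"
  using tree by (auto simp: graph_tree_def)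

lemma walk_of_dist: "(adj ^^ d x y) x y"
proof -
  have "adj\<^sup>*\<^sup>* x y"
    using tree by (auto simp: graph_tree_def graph_connected_def)
  then have "\<exists>n. (adj ^^ n) x y"
    by (simp add: rtranclp_power)
  then show ?thesis
    unfolding graph_dist_def by (rule LeastI_ex)
qed

lemma dist_le: "(adj ^^ n) x y \<Longrightarrow> d x y \<le> n"
  unfolding graph_dist_def by (rule Least_le)

lemma dist_self [simp]: "d x x = 0"
  using dist_le[of 0 x x] by simp

lemma dist_eq_0_iff [simp]: "d x y = 0 \<longleftrightarrow> x = y"
  using walk_of_dist[of x y] by (cases "d x y = 0") auto

lemma dist_sym: "d x y = d y x"
proof -
  have rev: "(adj ^^ n) x y \<Longrightarrow> (adj ^^ n) y x" for n x y
  proof (induction n arbitrary: y)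
    case (Suc n)
    then obtain z where "(adj ^^ n) z x" "adj z y"
      by auto
    then show ?case
      by (meson adj_sym relpowp_Suc_I2)
  qed auto
  show ?thesis
    using dist_le[OF rev[OF walk_of_dist]] by (metis order_antisym)
qed

lemma dist_triangle: "d x z \<le> d x y + d y z"
proof -
  have "(adj ^^ (d x y + d y z)) x z"
    unfolding relpowp_add using walk_of_dist by blast
  then show ?thesis by (rule dist_le)
qed

lemma dist_adj: "adj x y \<Longrightarrow> d x y = 1"
  using dist_le[of 1 x y] adj_irrefl[of x] by (cases "d x y") auto

lemma adj_of_dist: "d x y = 1 \<Longrightarrow> adj x y"
  using walk_of_dist[of x y] by auto

lemma dist_adj_le: "adj x y \<Longrightarrow> d a y \<le> Suc (d a x)"
  using dist_triangle[of a y x] dist_adj[of x y] by simp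

lemma closer_exists:
  assumes "x \<noteq> a"
  obtains z where "adj x z" "d a x = Suc (d a z)"
proof -
  obtain n where n: "d a x = Suc n"
    using assms by (cases "d a x") auto
  then obtain z where z: "(adj ^^ n) a z" "adj z x"
    using walk_of_dist[of a x] by auto
  have "d a z = n"
    using dist_le[OF z(1)] dist_adj_le[OF z(2), of a] n by simp
  with that z n show ?thesis
    by (metis adj_sym)
qed

text \<open>
  This is how the absence of cycles is exploited: two vertices at equal distance from \<open>a\<close> are
  joined by a path that stays within that distance, so any further connection between them outside
  this ball closes a cycle. The length bound holds because the vertices are joined through
  vertices nearer to \<open>a\<close>, and it makes the closed path an admissible cycle when they are adjacent.
\<close>

lemma path_between_equidistant:
  assumes "d a y = n" "d a y' = n" "y \<noteq> y'"
  shows "\<exists>xs. length xs \<ge> 3 \<and> distinct xs \<and> successively adj xs \<and> hd xs = y \<and> last xs = y'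
    \<and> (\<forall>x\<in>set xs. d a x \<le> n)"
  using assms
proof (induction n arbitrary: y y')
  case (Suc n)
  have "y \<noteq> a" "y' \<noteq> a" using Suc.prems by auto
  then obtain z z' where z: "adj y z" "d a y = Suc (d a z)" and z': "adj y' z'" "d a y' = Suc (d a z')"
    by (metis closer_exists)
  have zn: "d a z = n" "d a z' = n" using Suc.prems z z' by auto
  show ?case
  proof (cases "z = z'")
    case True
    have "successively adj [y, z, y']" using z z' True by (simp add: adj_sym)
    moreover have "distinct [y, z, y']"
      using Suc.prems z z' True by auto
    ultimately show ?thesis
      using Suc.prems zn by (intro exI[of _ "[y, z, y']"]) auto
  next
    case False
    from Suc.IH[OF zn False] obtain xs where xs: "length xs \<ge> 3" "distinct xs" "successively adj xs"
      "hd xs = z" "last xs = z'" "\<forall>x\<in>set xs. d a x \<le> n" by blast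
    then have ne: "xs \<noteq> []" by auto
    have "y \<notin> set xs" "y' \<notin> set xs" using xs(6) Suc.prems by force+
    moreover have "successively adj (y # xs @ [y'])"
      using xs ne z z' by (auto simp: successively_Cons successively_append_iff adj_sym)
    ultimately show ?thesis
      using xs ne Suc.prems by (intro exI[of _ "y # xs @ [y']"]) auto
  qed
qed auto

text \<open>
  With two neighbours nearer to \<open>a\<close>, the path joining them and \<open>x\<close> would form a cycle.
\<close>

lemma closer_unique:
  assumes "adj x y" "adj x y'" "d a x = Suc (d a y)" "d a x = Suc (d a y')"
  shows "y = y'"
proof (rule ccontr)
  assume "y \<noteq> y'"
  then obtain xs where xs: "length xs \<ge> 3" "distinct xs" "successively adj xs" "hd xs = y"
    "last xs = y'" "\<forall>x\<in>set xs. d a x \<le> d a y"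
    using path_between_equidistant[of a y "d a y" y'] assms by auto
  then have "x \<notin> set xs" "xs \<noteq> []" using assms(3) by force+
  then have "graph_cycle adj (x # xs)"
    using xs assms by (auto simp: graph_cycle_def successively_Cons adj_sym)
  then show False by (simp add: no_cycle)
qed

text \<open>
  Trees are bipartite: adjacent vertices at equal distance from \<open>a\<close> would be joined by a longer
  path as well.
\<close>

lemma dist_adj_cases:
  assumes "adj x y"
  shows "d a y = Suc (d a x) \<or> d a x = Suc (d a y)"
proof (rule ccontr)
  assume contr: "\<not> ?thesis"
  then have "d a y = d a x"
    using dist_adj_le[OF assms, of a] dist_adj_le[OF adj_sym[OF assms], of a] by linarith
  moreover have "y \<noteq> x" using assms adj_irrefl by auto
  ultimately obtain xs where "length xs \<ge> 3" "distinct xs" "successively adj xs" "hd xs = y"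
    "last xs = x"
    using path_between_equidistant[OF refl, of a x y] by metis
  then have "graph_cycle adj xs"
    using assms by (auto simp: graph_cycle_def)
  then show False by (simp add: no_cycle)
qed

text \<open>
  The two half-trees of an edge: every vertex is nearer to exactly one of its endpoints.
\<close>

lemma dist_edge_cases:
  assumes "adj a b"
  obtains "d b x = Suc (d a x)" | "d a x = Suc (d b x)"
  using dist_adj_cases[OF assms, of x] unfolding dist_sym[of x a] dist_sym[of x b] by blast

lemma farther:
  assumes "adj x y" "adj x z" "d a x = Suc (d a y)" "z \<noteq> y"
  shows "d a z = Suc (d a x)"
  using dist_adj_cases[OF assms(2), of a] closer_unique[OF assms(1,2,3)] assms(4) by auto

text \<open>
  If \<open>v\<close> lies behind the edge from \<open>u\<close> to \<open>w\<close> and \<open>z\<close> lies beyond it, the geodesic from \<open>v\<close> to \<open>z\<close>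
  crosses the edge. Walking from \<open>w\<close> to \<open>z\<close>, the neighbour nearer to \<open>v\<close> is always the previous
  vertex, so by its uniqueness each step increases the distance from \<open>v\<close>.
\<close>

lemma dist_concat:
  assumes "adj u w" "d v w = Suc (d v u)" "d u z = Suc (d w z)"
  shows "d v z = Suc (d v u + d w z)"
  using assms(3)
proof (induction "d w z" arbitrary: z rule: less_induct)
  case less
  show ?case
  proof (cases "z = w")
    case True
    then show ?thesis using assms by simp
  next
    case False
    then obtain z' where z': "adj z z'" "d w z = Suc (d w z')"
      by (rule closer_exists)
    have uz': "d u z' = Suc (d w z')"
      using dist_adj_le[OF adj_sym[OF z'(1)], of u] dist_triangle[of u z' w] dist_adj[OF assms(1)]
        less.prems z' by simp
    have vz': "d v z' = Suc (d v u + d w z')"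
      using less.hyps[of z'] z' uz' by simp
    obtain t where t: "adj z' t" "d v z' = Suc (d v t)" "t \<noteq> z"
    proof (cases "z' = w")
      case True
      have "u \<noteq> z" using less.prems by auto
      then show ?thesis using that[of u] True assms by (auto simp: adj_sym)
    next
      case False
      then obtain t where t: "adj z' t" "d w z' = Suc (d w t)"
        by (rule closer_exists)
      have "d u t = Suc (d w t)"
        using dist_adj_le[OF adj_sym[OF t(1)], of u] dist_triangle[of u t w] dist_adj[OF assms(1)]
          uz' t by simp
      then have "d v t = Suc (d v u + d w t)"
        using less.hyps[of t] z' t by simp
      moreover have "t \<noteq> z" using t z' by auto
      ultimately show ?thesis using that[of t] t z' vz' by simp
    qed
    have "d v z = Suc (d v z')"
      using farther[OF t(1) adj_sym[OF z'(1)] t(2)] t(3) by simp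
    then show ?thesis using vz' z' by simp
  qed
qed

text \<open>
  If \<open>x\<close> were not \<open>a\<close>, the neighbour of \<open>x\<close> nearer to \<open>a\<close> and the vertex \<open>y\<close> would be two
  neighbours of \<open>x\<close> nearer to \<open>b\<close>.
\<close>

lemma only_edge_between_halftrees:
  assumes ab: "adj a b" and xy: "adj x y" and side: "d a x < d b x" "d b y < d a y"
  shows "x = a \<and> y = b"
proof -
  have bx: "d b x = Suc (d a x)"
    using side by (cases rule: dist_edge_cases[OF ab, of x]) simp_all
  have ay: "d a y = Suc (d b y)"
    using side by (cases rule: dist_edge_cases[OF ab, of y]) simp_all
  have y: "d b x = Suc (d b y)" "d a y = Suc (d a x)"
    using dist_adj_cases[OF xy, of a] dist_adj_cases[OF xy, of b] bx ay by arith+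
  have "x = a"
  proof (rule ccontr)
    assume "x \<noteq> a"
    then obtain x' where x': "adj x x'" "d a x = Suc (d a x')" by (rule closer_exists)
    have "d b x' \<le> Suc (d a x')"
      using dist_triangle[of b x' a] dist_adj[OF adj_sym[OF ab]] by simp
    then have "d b x = Suc (d b x')"
      using dist_adj_cases[OF x'(1), of b] bx x'(2) by arith
    then have "x' = y" using closer_unique[OF x'(1) xy] y by blast
    then show False using x' y by simp
  qed
  then show ?thesis using bx y by simp
qed

definition btw :: "'v \<Rightarrow> 'v \<Rightarrow> 'v \<Rightarrow> bool"
  where "btw a b c \<longleftrightarrow> d a c = d a b + d b c"

lemma btw_ends [simp]: "btw a a c" "btw a c c"
  by (auto simp: btw_def)

lemma btw_trans: "btw a b c \<Longrightarrow> btw a c e \<Longrightarrow> btw a b e"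
  using dist_triangle[of b e c] dist_triangle[of a e b] by (simp add: btw_def)

lemma btw_exists:
  assumes "i \<le> d a c"
  shows "\<exists>b. d a b = i \<and> btw a b c"
  using assms
proof (induction "d a c - i" arbitrary: c)
  case 0
  then show ?case by (intro exI[of _ c]) simp
next
  case (Suc n)
  then have "c \<noteq> a" by auto
  then obtain z where z: "adj c z" "d a c = Suc (d a z)"
    by (rule closer_exists)
  have "btw a z c" using z dist_adj[of c z] by (simp add: btw_def dist_sym[of z c])
  with Suc.hyps(1)[of z] Suc.hyps(2) z show ?case
    by (metis Suc_leI Suc_diff_le btw_trans diff_Suc_1 diff_is_0_eq' nat_le_linear not_less_eq_eq old.nat.distinct(1))
qed

lemma btw_unique:
  assumes "btw a b c" "btw a b' c" "d a b = d a b'"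
  shows "b = b'"
  using assms
proof (induction "d b c" arbitrary: c)
  case 0
  then show ?case by (auto simp: btw_def)
next
  case (Suc n)
  then have bc: "b \<noteq> c" "b' \<noteq> c"
    by (auto simp: btw_def)
  have step: "adj c z \<and> d a c = Suc (d a z) \<and> btw a b z"
    if "btw a b c" "adj c z" "d b c = Suc (d b z)" for b z
    using that dist_adj_le[of z c a] adj_sym[of c z] dist_triangle[of a z b] by (auto simp: btw_def)
  obtain z where z: "adj c z" "d b c = Suc (d b z)" using bc closer_exists by metis
  obtain z' where z': "adj c z'" "d b' c = Suc (d b' z')" using bc closer_exists by metis
  have 1: "d a c = Suc (d a z)" "btw a b z" using step[of b z] z Suc.prems by auto
  have 2: "d a c = Suc (d a z')" "btw a b' z'" using step[of b' z'] z' Suc.prems by auto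
  have "z = z'" using closer_unique[of c z z' a] z z' 1 2 by auto
  then show ?case
    using Suc.hyps(1)[of z] Suc.hyps(2) z 1 2 Suc.prems(3) by simp
qed

lemma btw_linear:
  assumes "btw a b e" "btw a c e" "d a b \<le> d a c"
  shows "btw a b c"
proof -
  obtain b' where b': "d a b' = d a b" "btw a b' c"
    using btw_exists[OF assms(3)] by auto
  then have "b' = b"
    using btw_unique[of a b' e b] btw_trans[OF b'(2) assms(2)] assms by auto
  with b' show ?thesis by simp
qed

text \<open>
  Only one neighbour of a vertex is nearer to the starting point, and it is the one the walk came
  from.
\<close>

lemma nonbacktracking_geodesic:
  assumes "\<And>n. adj (r n) (r (Suc n))" "\<And>n. r (Suc (Suc n)) \<noteq> r n"
  shows "d (r m) (r (m + n)) = n"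
proof -
  have "d (r m) (r (m + n)) = n \<and> d (r m) (r (Suc (m + n))) = Suc n"
  proof (induction n)
    case 0
    then show ?case using dist_adj[OF assms(1)[of m]] by simp
  next
    case (Suc n)
    have "d (r m) (r (Suc (Suc (m + n)))) = Suc (Suc n)"
      using farther[of "r (Suc (m + n))" "r (m + n)" "r (Suc (Suc (m + n)))" "r m"] assms Suc
      by (simp add: adj_sym)
    with Suc show ?case by simp
  qed
  then show ?thesis ..
qed

lemma nonbacktracking_ray:
  assumes "\<And>n. adj (r n) (r (Suc n))" "\<And>n. r (Suc (Suc n)) \<noteq> r n"
  shows "r \<in> rays adj"
proof -
  have neq: "r m \<noteq> r n" if "m < n" for m n
    using nonbacktracking_geodesic[of r m "n - m"] assms that by fastforce
  have "inj r"
  proof (rule injI)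
    fix m n assume "r m = r n"
    then show "m = n" using neq[of m n] neq[of n m] by (cases m n rule: linorder_cases) auto
  qed
  then show ?thesis using assms(1) by (simp add: rays_def)
qed

lemma dist_aut:
  assumes "g \<in> graph_aut adj"
  shows "d (g x) (g y) = d x y"
proof -
  have g: "bij g" "\<And>x y. adj (g x) (g y) \<longleftrightarrow> adj x y"
    using assms by (auto simp: graph_aut_def)
  have "(adj ^^ n) (g x) (g y) \<longleftrightarrow> (adj ^^ n) x y" for n
  proof (induction n arbitrary: y)
    case 0
    then show ?case using g(1) by (simp add: bij_is_inj inj_eq)
  next
    case (Suc n)
    have "(\<exists>z. (adj ^^ n) (g x) z \<and> adj z (g y)) \<longleftrightarrow> (\<exists>z. (adj ^^ n) (g x) (g z) \<and> adj (g z) (g y))"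
      using g(1) by (metis bij_pointE)
    then show ?case by (simp add: relcompp.simps Suc g(2)) 
  qed
  then show ?thesis by (simp add: graph_dist_def)
qed

end


section \<open>Regular trees\<close>

locale regular_tree_graph = tree_graph adj
  for adj :: "'v \<Rightarrow> 'v \<Rightarrow> bool" +
  fixes q :: nat
  assumes q_ge_2: "q \<ge> 2"
    and finite_nbrs: "finite {y. adj x y}"
    and card_nbrs: "card {y. adj x y} = q + 1"
begin

lemma third_nbr:
  obtains e where "adj x e" "e \<noteq> c" "e \<noteq> c'"
proof -
  have "card {c, c'} \<le> 2" by (simp add: card_insert_if)
  then have "card {c, c'} < card {y. adj x y}"
    unfolding card_nbrs using q_ge_2 by linarith
  then have "\<not> {y. adj x y} \<subseteq> {c, c'}"
    by (meson card_mono finite.emptyI finite_insert linorder_not_le)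
  with that show ?thesis by auto
qed

text \<open>
  The crude bound \<open>(q + 1)\<^sup>n\<close> is enough for square-summability below, because \<open>q + 1 < q\<^sup>2\<close>.
\<close>

lemma sphere: "finite {y. d x y = n} \<and> card {y. d x y = n} \<le> (q + 1) ^ n"
proof (induction n)
  case 0
  have "{y. d x y = 0} = {x}" by auto
  then show ?case by simp
next
  case (Suc n)
  have sub: "{y. d x y = Suc n} \<subseteq> (\<Union>z\<in>{y. d x y = n}. {y. adj z y})"
  proof
    fix y assume y: "y \<in> {y. d x y = Suc n}"
    then have "y \<noteq> x" by auto
    then obtain z where "adj y z" "d x y = Suc (d x z)" by (rule closer_exists)
    with y show "y \<in> (\<Union>z\<in>{y. d x y = n}. {y. adj z y})" by (auto simp: adj_sym)
  qed
  have fin: "finite (\<Union>z\<in>{y. d x y = n}. {y. adj z y})"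
    using Suc finite_nbrs by auto
  have "card {y. d x y = Suc n} \<le> card (\<Union>z\<in>{y. d x y = n}. {y. adj z y})"
    by (rule card_mono[OF fin sub])
  also have "\<dots> \<le> (\<Sum>z\<in>{y. d x y = n}. card {y. adj z y})"
    using Suc by (intro card_UN_le) simp
  also have "\<dots> = card {y. d x y = n} * (q + 1)"
    by (simp add: card_nbrs)
  also have "\<dots> \<le> (q + 1) ^ n * (q + 1)"
    using Suc by (intro mult_right_mono) auto
  also have "\<dots> = (q + 1) ^ Suc n" by simp
  finally show ?case using finite_subset[OF sub fin] by simp
qed

lemma countable_vertices: "countable (UNIV :: 'v set)"
proof -
  have "(UNIV :: 'v set) = (\<Union>n. {y. d x y = n})" for x by auto
  moreover have "countable (\<Union>n. {y. d x y = n})" for x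
    using sphere by (intro countable_UN) (auto intro: countable_finite)
  ultimately show ?thesis by metis
qed

text \<open>
  A vertex has at least three neighbours, so a ray can avoid backtracking and one forbidden
  successor at each step.
\<close>

lemma ray_avoiding:
  fixes f :: "'v \<Rightarrow> 'v"
  obtains s where "s \<in> rays adj" "s 0 = x" "\<And>n. s (Suc n) \<noteq> f (s n)"
proof -
  let ?P = "\<lambda>n (a, b). adj a b \<and> b \<noteq> f a \<and> (n = (0::nat) \<longrightarrow> a = x)"
  let ?Q = "\<lambda>n (a, b) (a', b'). a' = b \<and> b' \<noteq> a"
  have "\<exists>S. \<forall>n. ?P n (S n) \<and> ?Q n (S n) (S (Suc n))"
  proof (rule dependent_nat_choice)
    obtain e where "adj x e" "e \<noteq> f x" by (rule third_nbr)
    then show "\<exists>p. ?P 0 p" by auto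
  next
    fix p n assume "?P n p"
    obtain a b where p: "p = (a, b)" by (cases p)
    obtain e where "adj b e" "e \<noteq> a" "e \<noteq> f b" by (rule third_nbr)
    then show "\<exists>p'. ?P (Suc n) p' \<and> ?Q n p p'"
      by (intro exI[of _ "(b, e)"]) (auto simp: p)
  qed
  then obtain S where "\<forall>n. ?P n (S n) \<and> ?Q n (S n) (S (Suc n))" ..
  then have S: "?P n (S n)" "?Q n (S n) (S (Suc n))" for n by simp_all
  define s where "s n = fst (S n)" for n
  have nxt: "s (Suc n) = snd (S n)" for n
    using S(2)[of n] by (auto simp: s_def split: prod.splits)
  have adj: "adj (s n) (s (Suc n))" and av: "s (Suc n) \<noteq> f (s n)" for n
    using S(1)[of n] unfolding nxt by (auto simp: s_def split: prod.splits)
  have "s (Suc (Suc n)) \<noteq> s n" for n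
    using S(2)[of n] unfolding nxt by (auto simp: s_def split: prod.splits)
  with adj have "s \<in> rays adj" by (intro nonbacktracking_ray)
  moreover have "s 0 = x" using S(1)[of 0] by (auto simp: s_def split: prod.splits)
  ultimately show ?thesis using that av by blast
qed

lemma extend_geodesic:
  "\<exists>z. btw x y z \<and> d x z = d x y + n"
proof (induction n)
  case 0
  show ?case by (intro exI[of _ y]) simp
next
  case (Suc n)
  then obtain z where z: "btw x y z" "d x z = d x y + n" by blast
  obtain e where e: "adj z e" "d x e = Suc (d x z)"
  proof (cases "z = x")
    case True
    obtain e where "adj z e" by (rule third_nbr)
    then show ?thesis using that[of e] True dist_adj by simp
  next
    case False
    then obtain p where p: "adj z p" "d x z = Suc (d x p)" by (rule closer_exists)
    obtain e where "adj z e" "e \<noteq> p" by (rule third_nbr)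
    then show ?thesis using that[of e] farther p by blast
  qed
  have "btw x z e" using e dist_adj[OF e(1)] by (simp add: btw_def)
  then show ?case using z e btw_trans by (intro exI[of _ e]) auto
qed

lemma infinite_vertices: "infinite (UNIV :: 'v set)"
proof -
  obtain r :: "nat \<Rightarrow> 'v" where "r \<in> rays adj" using ray_avoiding by blast
  then have "inj r" by (simp add: rays_def)
  then show ?thesis using finite_imageD[of r UNIV] finite_subset[of "range r" UNIV] by auto
qed

end


section \<open>Boundary transitivity implies distance transitivity\<close>

locale boundary_transitive_tree = regular_tree_graph adj q
  for adj :: "'v \<Rightarrow> 'v \<Rightarrow> bool" and q +
  fixes G :: "('v \<Rightarrow> 'v) set"
  assumes subgroup: "subgroup G (aut_group adj)"
    and vertex_trans: "vertex_transitive G"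
    and boundary_trans: "boundary_transitive adj G"
begin

lemma G_aut: "g \<in> G \<Longrightarrow> g \<in> graph_aut adj"
  using subgroup.subset[OF subgroup] by (auto simp: aut_group_def)

lemma G_id: "id \<in> G"
  using subgroup.one_closed[OF subgroup] by (simp add: aut_group_def)

lemma G_comp: "g \<in> G \<Longrightarrow> h \<in> G \<Longrightarrow> g \<circ> h \<in> G"
  using subgroup.m_closed[OF subgroup] by (simp add: aut_group_def)

lemma G_inv:
  assumes "g \<in> G"
  shows "\<exists>h\<in>G. (\<forall>x. h (g x) = x) \<and> (\<forall>x. g (h x) = x)"
proof -
  let ?A = "aut_group adj"
  let ?h = "inv\<^bsub>?A\<^esub> g"
  have g: "g \<in> carrier ?A" using assms G_aut by (simp add: aut_group_def)
  have h: "?h \<in> G" using subgroup.m_inv_closed[OF subgroup assms] .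
  have 1: "?h \<circ> g = id" using group.l_inv[OF group_aut_group g] by (simp add: aut_group_def)
  have 2: "g \<circ> ?h = id" using group.r_inv[OF group_aut_group g] by (simp add: aut_group_def)
  show ?thesis using h fun_cong[OF 1] fun_cong[OF 2] by (intro bexI[of _ ?h]) auto
qed

lemma G_adj: "g \<in> G \<Longrightarrow> adj (g x) (g y) \<longleftrightarrow> adj x y"
  using G_aut by (auto simp: graph_aut_def)

lemma G_dist: "g \<in> G \<Longrightarrow> d (g x) (g y) = d x y"
  using G_aut dist_aut by blast

text \<open>
  A group element carrying one geodesic to another carries its points to the points at the same
  distances.
\<close>

lemma G_btw:
  assumes "g \<in> G" "btw v x z" "btw (g v) x' (g z)" "d v x = d (g v) x'"
  shows "g x = x'"
proof (rule btw_unique)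
  show "btw (g v) (g x) (g z)" using assms by (simp add: btw_def G_dist)
qed (use assms in \<open>auto simp: G_dist\<close>)

text \<open>
  Transitivity on ends in terms of representing rays: an equality of ends is agreement of tails.
\<close>

lemma boundary_trans_rays:
  assumes r: "r \<in> rays adj" and s: "s \<in> rays adj"
  obtains g m n where "g \<in> G" "\<And>k. g (r (m + k)) = s (n + k)"
proof -
  have "ray_equiv adj `` {r} \<in> tree_ends adj" "ray_equiv adj `` {s} \<in> tree_ends adj"
    using r s by (auto simp: tree_ends_def quotient_def)
  then obtain g where g: "g \<in> G" "end_action g (ray_equiv adj `` {r}) = ray_equiv adj `` {s}"
    using boundary_trans unfolding boundary_transitive_def by blast
  have "r \<in> ray_equiv adj `` {r}" using r by (auto simp: ray_equiv_def)
  then have "g \<circ> r \<in> ray_equiv adj `` {s}"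
    using g(2) by (auto simp: end_action_def)
  then obtain m n where "\<And>k. s (n + k) = (g \<circ> r) (m + k)"
    by (auto simp: ray_equiv_def)
  then show ?thesis using that[OF g(1), of m n] by simp
qed

text \<open>
  Transitivity of the stabiliser of the oriented edge on the levels of the half-tree behind it.
  For stabilisers in a closed group this is transitivity on the ends of the half-tree; the levels
  avoid any limiting argument.
\<close>

definition halftree_transitive :: "'v \<Rightarrow> 'v \<Rightarrow> bool"
  where "halftree_transitive u w \<longleftrightarrow> adj u w \<and>
    (\<forall>x y. d u x = Suc (d w x) \<longrightarrow> d u y = Suc (d w y) \<longrightarrow> d w x = d w y \<longrightarrow>
      (\<exists>g\<in>G. g u = u \<and> g w = w \<and> g x = y))"

text \<open>
  An element fixing \<open>u\<close> and \<open>w\<close> that moves \<open>x\<close> to \<open>y\<close>, both beyond \<open>c\<close>, also fixes \<open>c\<close>, since \<open>c\<close>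
  lies at the same place on both geodesics.
\<close>

lemma halftree_transitive_forward:
  assumes "halftree_transitive u w" "adj w c" "c \<noteq> u"
  shows "halftree_transitive w c"
  unfolding halftree_transitive_def
proof (intro conjI allI impI)
  fix x y
  assume xy: "d w x = Suc (d c x)" "d w y = Suc (d c y)" "d c x = d c y"
  have uw: "adj u w" using assms(1) by (simp add: halftree_transitive_def)
  have "d u c = Suc (d u w)"
    using farther[of w u c u] uw assms by (simp add: adj_sym dist_adj)
  then have "d u z = Suc (d w z)" if "d w z = Suc (d c z)" for z
    using dist_concat[OF assms(2) _ that, of u] that dist_adj[OF uw] by simp
  then obtain g where g: "g \<in> G" "g u = u" "g w = w" "g x = y"
    using xy assms(1) by (metis halftree_transitive_def)
  have "g c = c"
    using xy g dist_adj[OF assms(2)] by (intro G_btw[of g w c x c]) (auto simp: btw_def)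
  with g show "\<exists>g\<in>G. g w = w \<and> g c = c \<and> g x = y" by auto
qed (fact assms)

lemma halftree_transitive_translate:
  assumes "halftree_transitive u w" "g \<in> G"
  shows "halftree_transitive (g u) (g w)"
  unfolding halftree_transitive_def
proof (intro conjI allI impI)
  show "adj (g u) (g w)" using assms by (simp add: halftree_transitive_def G_adj)
  fix x y
  assume xy: "d (g u) x = Suc (d (g w) x)" "d (g u) y = Suc (d (g w) y)" "d (g w) x = d (g w) y"
  obtain h where h: "h \<in> G" "\<And>x. h (g x) = x" "\<And>x. g (h x) = x"
    using G_inv[OF assms(2)] by blast
  have pull: "d z (h x) = d (g z) x" for z x
    using G_dist[OF assms(2), of z "h x"] by (simp add: h)
  have "\<exists>k\<in>G. k u = u \<and> k w = w \<and> k (h x) = h y"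
    using assms(1) xy by (simp add: halftree_transitive_def pull)
  then obtain k where k: "k \<in> G" "k u = u" "k w = w" "k (h x) = h y" by blast
  have "g \<circ> k \<circ> h \<in> G" using assms k h by (simp add: G_comp)
  then show "\<exists>k\<in>G. k (g u) = g u \<and> k (g w) = g w \<and> k x = y"
    using k h by (intro bexI[of _ "g \<circ> k \<circ> h"]) auto
qed

text \<open>
  The images of the end of \<open>r\<close> are sorted by the image \<open>v\<close> of its origin, because two group
  elements with the same \<open>v\<close> differ by an element fixing \<open>v\<close>. An image lies behind \<open>x\<close>, as seen
  from the origin of \<open>r\<close>, when this holds for a tail of the ray.
\<close>

definition orbit_meets :: "(nat \<Rightarrow> 'v) \<Rightarrow> 'v \<Rightarrow> 'v \<Rightarrow> bool"
  where "orbit_meets r v x \<longleftrightarrow> (\<exists>g\<in>G. g (r 0) = v \<and> (\<exists>N. \<forall>k\<ge>N. btw (r 0) x (g (r k))))"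

text \<open>
  The step of the diagonal construction: below any vertex there is another one whose ends avoid
  all images of the end of \<open>r\<close> under elements taking the origin of \<open>r\<close> to \<open>v\<close>. Go down until \<open>v\<close>
  is no longer below, and take two vertices below that witness the failure of transitivity. If
  both were met, the quotient of the two group elements would fix \<open>v\<close>, hence the edge, and map one
  of the two vertices to the other.
\<close>

lemma orbit_escapes:
  assumes r: "r \<in> rays adj" and bad: "\<And>u w. \<not> halftree_transitive u w"
  shows "\<exists>y'. btw (r 0) y y' \<and> d (r 0) y < d (r 0) y' \<and> \<not> orbit_meets r v y'"
proof -
  define x0 where "x0 = r 0"
  obtain y1 where y1: "btw x0 y y1" "d x0 y1 = d x0 y + Suc (d x0 v)"
    using extend_geodesic by blast
  then have "y1 \<noteq> x0" by auto
  then obtain p where p: "adj y1 p" "d x0 y1 = Suc (d x0 p)" by (rule closer_exists)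
  have py: "adj p y1" using p by (simp add: adj_sym)
  from bad[of p y1] py obtain x x' where x: "d p x = Suc (d y1 x)" and x': "d p x' = Suc (d y1 x')"
    and xx: "d y1 x = d y1 x'" and no: "\<And>g. g \<in> G \<Longrightarrow> g p = p \<Longrightarrow> g y1 = y1 \<Longrightarrow> g x \<noteq> x'"
    unfolding halftree_transitive_def by blast
  have beyond: "d x0 z = d x0 y1 + d y1 z" if "d p z = Suc (d y1 z)" for z
    using dist_concat[OF py p(2) that] p(2) by simp
  \<comment> \<open>By the choice of the level of \<open>y1\<close>, the vertex \<open>v\<close> is not behind the edge from \<open>p\<close> to \<open>y1\<close>.\<close>
  have vy: "d v y1 = Suc (d v p)"
  proof (rule ccontr)
    assume "\<not> ?thesis"
    then have "d p v = Suc (d y1 v)"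
      using dist_adj_cases[OF py, of v] by (simp add: dist_sym)
    from beyond[OF this] y1 show False by simp
  qed
  have vz: "d v z = Suc (d v p + d y1 z)" if "d p z = Suc (d y1 z)" for z
    by (rule dist_concat[OF py vy that])
  have geo: "btw v p z \<and> btw v y1 z \<and> btw v w z"
    if w: "d p w = Suc (d y1 w)" and z: "btw x0 w z" for w z
  proof -
    have yz: "d y1 z = d y1 w + d w z"
      using beyond[OF w] z dist_triangle[of x0 z y1] dist_triangle[of y1 z w] by (simp add: btw_def)
    have pz: "d p z = Suc (d y1 z)"
      using beyond[OF w] z yz p(2) dist_triangle[of x0 z p] dist_adj_le[OF p(1), of z]
      by (simp add: btw_def dist_sym)
    show ?thesis using vz[OF pz] vz[OF w] vy pz yz by (simp add: btw_def)
  qed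
  have "\<not> (orbit_meets r v x \<and> orbit_meets r v x')"
  proof
    assume "orbit_meets r v x \<and> orbit_meets r v x'"
    then obtain g N g' N' where g: "g \<in> G" "g x0 = v" "\<And>k. k \<ge> N \<Longrightarrow> btw x0 x (g (r k))"
      and g': "g' \<in> G" "g' x0 = v" "\<And>k. k \<ge> N' \<Longrightarrow> btw x0 x' (g' (r k))"
      unfolding orbit_meets_def x0_def[symmetric] by blast
    obtain h where h: "h \<in> G" "\<And>x. h (g x) = x" "\<And>x. g (h x) = x"
      using G_inv[OF g(1)] by blast
    \<comment> \<open>Beyond both thresholds the two images of \<open>r k\<close> lie at the same distance \<open>k\<close> from \<open>v\<close>, behind \<open>x\<close> and \<open>x'\<close>.\<close>
    define k where "k = max N N'"
    define t where "t = g' \<circ> h"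
    have t: "t \<in> G" "t v = v" "t (g (r k)) = g' (r k)"
      using G_comp[OF g'(1) h(1)] h(2)[of x0] h(2)[of "r k"] g(2) g'(2) by (simp_all add: t_def)
    have 1: "btw v p (g (r k))" "btw v y1 (g (r k))" "btw v x (g (r k))"
      using geo[OF x g(3)[of k]] by (auto simp: k_def)
    have 2: "btw v p (g' (r k))" "btw v y1 (g' (r k))" "btw v x' (g' (r k))"
      using geo[OF x' g'(3)[of k]] by (auto simp: k_def)
    have "t p = p" "t y1 = y1" "t x = x'"
      using G_btw[OF t(1) 1(1), of p] G_btw[OF t(1) 1(2), of y1] G_btw[OF t(1) 1(3), of x']
        2 t vz[OF x] vz[OF x'] xx by simp_all
    then show False using no t(1) by blast
  qed
  moreover have "btw x0 y z \<and> d x0 y < d x0 z" if "d p z = Suc (d y1 z)" for z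
  proof -
    have "btw x0 y1 z" using beyond[OF that] by (simp add: btw_def)
    then show ?thesis using y1 btw_trans[of x0 y y1 z] by (simp add: btw_def)
  qed
  ultimately show ?thesis using x x' unfolding x0_def by blast
qed

text \<open>
  Otherwise \<open>orbit_escapes\<close>, applied to an enumeration of all vertices as possible images of the origin,
  produces a ray whose end is not in the orbit of the end of \<open>r\<close>.
\<close>

lemma halftree_transitive_exists: "\<exists>u w. halftree_transitive u w"
proof (rule ccontr)
  assume "\<nexists>u w. halftree_transitive u w"
  then have bad: "\<And>u w. \<not> halftree_transitive u w" by blast
  obtain r where r: "r \<in> rays adj" using ray_avoiding by blast
  define x0 where "x0 = r 0"
  define e where "e = from_nat_into (UNIV :: 'v set)"
  have e: "range e = UNIV"
    unfolding e_def by (rule range_from_nat_into) (auto simp: countable_vertices)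
  have "\<exists>Y. \<forall>n. True \<and> (btw x0 (Y n) (Y (Suc n)) \<and> d x0 (Y n) < d x0 (Y (Suc n)) \<and> \<not> orbit_meets r (e n) (Y (Suc n)))"
    using orbit_escapes[OF r bad, folded x0_def] by (intro dependent_nat_choice) simp_all
  then obtain Y where Y: "\<And>n. btw x0 (Y n) (Y (Suc n))" "\<And>n. d x0 (Y n) < d x0 (Y (Suc n))"
    "\<And>n. \<not> orbit_meets r (e n) (Y (Suc n))" by blast
  have mono: "btw x0 (Y n) (Y m)" if "n \<le> m" for n m
    using that by (induction rule: dec_induct) (auto intro: btw_trans Y)
  have far: "n \<le> d x0 (Y n)" for n
  proof (induction n)
    case (Suc n) then show ?case using Y(2)[of n] by simp
  qed simp
  \<comment> \<open>The nested geodesics from \<open>x0\<close> to the \<open>Y n\<close> exhaust a limit ray \<open>\<eta>\<close>.\<close>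
  have "\<exists>w. d x0 w = k \<and> btw x0 w (Y k)" for k
    using btw_exists[OF far] .
  then obtain \<eta> where \<eta>: "\<And>k. d x0 (\<eta> k) = k" "\<And>k. btw x0 (\<eta> k) (Y k)" by metis
  have up: "btw x0 (\<eta> k) (Y m)" if "k \<le> m" for k m
    using btw_trans[OF \<eta>(2) mono[OF that]] .
  have lin: "btw x0 (\<eta> j) (\<eta> k)" if "j \<le> k" for j k
    using btw_linear[OF up[OF that] \<eta>(2)] that by (simp add: \<eta>)
  have "adj (\<eta> k) (\<eta> (Suc k))" for k
    using lin[of k "Suc k"] by (intro adj_of_dist) (simp add: btw_def \<eta>)
  moreover have "inj \<eta>" using \<eta>(1) by (metis injI)
  ultimately have "\<eta> \<in> rays adj" by (simp add: rays_def)
  with r obtain g m l where g: "g \<in> G" "\<And>k. g (r (m + k)) = \<eta> (l + k)"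
    by (rule boundary_trans_rays) blast
  \<comment> \<open>The end of \<open>\<eta>\<close> is the image of that of \<open>r\<close> under \<open>g\<close>, but step \<open>n\<close> excluded all elements taking \<open>x0\<close> to \<open>g x0\<close>.\<close>
  obtain n where n: "e n = g x0" using e by (metis surj_def)
  define D where "D = d x0 (Y (Suc n))"
  have "btw x0 (Y (Suc n)) (\<eta> j)" if "D \<le> j" for j
    by (rule btw_linear[OF mono[of _ "max (Suc n) j"] up[of _ "max (Suc n) j"]])
      (use that in \<open>auto simp: \<eta> D_def\<close>)
  then have "btw x0 (Y (Suc n)) (g (r k))" if "m + D \<le> k" for k
    using g(2)[of "k - m"] that by simp
  then have "orbit_meets r (e n) (Y (Suc n))"
    unfolding orbit_meets_def using g(1) n by (auto simp: x0_def)
  then show False using Y(3)[of n] by simp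
qed

text \<open>
  By \<open>halftree_transitive_forward\<close> and vertex transitivity every vertex has at most one outgoing edge that is not
  transitive. If there is one, it leads to a parent \<open>p x\<close>, and \<open>p\<close> commutes with the group. Every
  image of the ray of iterated parents then consists of iterated parents, so its end is never that
  of a ray which avoids stepping to the parent.
\<close>

lemma halftree_transitive_all:
  assumes "adj z w"
  shows "halftree_transitive z w"
proof (rule ccontr)
  assume not_transitive: "\<not> halftree_transitive z w"
  obtain u0 w0 where g0: "halftree_transitive u0 w0" using halftree_transitive_exists by blast
  have move: "\<exists>g\<in>G. g x = y" for x y
    using vertex_trans by (simp add: vertex_transitive_def)
  have at_most: "c = c'" if "adj x c" "\<not> halftree_transitive x c" "adj x c'" "\<not> halftree_transitive x c'" for x c c'
  proof -
    obtain g where g: "g \<in> G" "g w0 = x" using move by blast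
    then have "halftree_transitive (g u0) x" using halftree_transitive_translate[OF g0] by auto
    from halftree_transitive_forward[OF this] have "c = g u0" "c' = g u0" using that by metis+
    then show ?thesis by simp
  qed
  have transl: "halftree_transitive (g x) (g y) \<longleftrightarrow> halftree_transitive x y" if gG: "g \<in> G" for g x y
  proof
    assume "halftree_transitive (g x) (g y)"
    moreover obtain h where h: "h \<in> G" "\<And>x. h (g x) = x"
      using G_inv[OF gG] by blast
    ultimately show "halftree_transitive x y" using halftree_transitive_translate[of "g x" "g y" h] by simp
  qed (rule halftree_transitive_translate[OF _ gG])
  have "\<exists>c. adj x c \<and> \<not> halftree_transitive x c" for x
  proof -
    obtain g where "g \<in> G" "g z = x" using move by blast
    then show ?thesis using not_transitive assms transl[of g z w] G_adj[of g z w] by (intro exI[of _ "g w"]) simp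
  qed
  then obtain p where p: "\<And>x. adj x (p x)" "\<And>x. \<not> halftree_transitive x (p x)" by metis
  have p_eq: "c = p x" if "adj x c" "\<not> halftree_transitive x c" for x c
    using at_most[OF that p] .
  have p_equiv: "g (p x) = p (g x)" if "g \<in> G" for g x
    using p that by (intro p_eq) (auto simp: transl G_adj)
  \<comment> \<open>A transitive edge leads to a vertex at which at most the edge back fails to be transitive.\<close>
  have p_back: "p y = x" if "adj x y" "y \<noteq> p x" for x y
  proof (rule ccontr)
    assume "p y \<noteq> x"
    moreover have "halftree_transitive x y" using p_eq[of x y] that by blast
    ultimately have "halftree_transitive y (p y)" using halftree_transitive_forward p(1) by simp
    then show False using p(2) by simp
  qed
  \<comment> \<open>Otherwise \<open>p\<close> would be an involution everywhere, but a neighbour of \<open>x\<close> other than \<open>p x\<close> has parent \<open>x\<close>.\<close>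
  have pp: "p (p x) \<noteq> x" for x
  proof
    assume inv: "p (p x) = x"
    obtain y where y: "adj x y" "y \<noteq> p x" by (rule third_nbr)
    obtain g where g: "g \<in> G" "g x = y" using move by blast
    have "p (p y) = y" using p_equiv[OF g(1), of x] p_equiv[OF g(1), of "p x"] inv g(2) by simp
    then show False using p_back[OF y] y by simp
  qed
  define r where "r n = (p ^^ n) z" for n
  have "r \<in> rays adj"
    by (rule nonbacktracking_ray) (auto simp: r_def p pp)
  moreover obtain s where s: "s \<in> rays adj" "\<And>n. s (Suc n) \<noteq> p (s n)"
    using ray_avoiding[of z p] by blast
  ultimately obtain g m n where g: "g \<in> G" "\<And>k. g (r (m + k)) = s (n + k)"
    using boundary_trans_rays[of r s] by blast
  have "s (Suc n) = g (p (r m))" using g(2)[of 1] by (simp add: r_def)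
  also have "\<dots> = p (s n)" using g(2)[of 0] p_equiv[OF g(1)] by simp
  finally show False using s(2) by blast
qed

text \<open>
  With \<open>e\<close> a neighbour of \<open>x'\<close> off both geodesics, the stabiliser of the edge from \<open>e\<close> to \<open>x'\<close> is
  transitive on the spheres around \<open>x'\<close> within the half-tree beyond that edge.
\<close>

theorem distance_transitive:
  assumes "d x y = d x' y'"
  shows "\<exists>g\<in>G. g x = x' \<and> g y = y'"
proof -
  obtain h where h: "h \<in> G" "h x = x'"
    using vertex_trans by (auto simp: vertex_transitive_def)
  have eq: "d x' (h y) = d x' y'" using G_dist[OF h(1), of x y] h assms by simp
  have "\<exists>g\<in>G. g x' = x' \<and> g (h y) = y'"
  proof (cases "d x' y' = 0")
    case True
    then have "h y = y'" "x' = y'" using eq by auto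
    then show ?thesis using G_id by (intro bexI[of _ id]) auto
  next
    case False
    then have ne: "x' \<noteq> h y" "x' \<noteq> y'" using eq by auto
    obtain c where c: "adj x' c" "d (h y) x' = Suc (d (h y) c)" using ne(1) by (rule closer_exists)
    obtain c' where c': "adj x' c'" "d y' x' = Suc (d y' c')" using ne(2) by (rule closer_exists)
    obtain e where e: "adj x' e" "e \<noteq> c" "e \<noteq> c'" by (rule third_nbr)
    have "halftree_transitive e x'" using halftree_transitive_all e by (simp add: adj_sym)
    moreover have "d e (h y) = Suc (d x' (h y))" "d e y' = Suc (d x' y')"
      using farther[OF c(1) e(1) c(2)] farther[OF c'(1) e(1) c'(2)] e by (simp_all add: dist_sym)
    ultimately show ?thesis using eq unfolding halftree_transitive_def by blast
  qed
  then obtain g where g: "g \<in> G" "g x' = x'" "g (h y) = y'" by blast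
  show ?thesis
    using G_comp[OF g(1) h(1)] by (rule bexI[rotated]) (simp add: g h)
qed

end


section \<open>The neighbour average on radial kernels\<close>

text \<open>
  If the first step were an increase, log-convexity would make all later ratios at least as large,
  hence the growth exponential.
\<close>

lemma log_convex_linear_growth:
  fixes s :: "nat \<Rightarrow> real"
  assumes nonneg: "\<And>k. 0 \<le> s k"
    and convex: "\<And>k. (s (Suc k))\<^sup>2 \<le> s k * s (Suc (Suc k))"
    and growth: "\<And>k. s k \<le> A + B * real k"
  shows "s 1 \<le> s 0"
proof (rule ccontr)
  assume "\<not> s 1 \<le> s 0"
  then have less: "s 0 < s 1" by simp
  have pos0: "s 0 > 0"
  proof (rule ccontr)
    assume "\<not> s 0 > 0"
    then have "s 0 = 0" using nonneg[of 0] by simp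
    then show False using convex[of 0] less by simp
  qed
  define \<rho> where "\<rho> = s 1 / s 0"
  have \<rho>: "\<rho> > 1" using less pos0 by (simp add: \<rho>_def)
  have step: "s k > 0 \<and> \<rho> * s k \<le> s (Suc k)" for k
  proof (induction k)
    case 0
    then show ?case using pos0 by (simp add: \<rho>_def)
  next
    case (Suc k)
    have "0 < \<rho> * s k" using Suc \<rho> by simp
    then have pos: "s (Suc k) > 0" using Suc by linarith
    have "(\<rho> * s k) * s (Suc k) \<le> s (Suc k) * s (Suc k)"
      using Suc pos by (intro mult_right_mono) auto
    also have "\<dots> \<le> s k * s (Suc (Suc k))"
      using convex[of k] by (simp add: power2_eq_square)
    finally have "s k * (\<rho> * s (Suc k)) \<le> s k * s (Suc (Suc k))"
      by (simp add: mult_ac)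
    then show ?case using Suc pos by simp
  qed
  have geo: "s 0 * \<rho> ^ k \<le> s k" for k
  proof (induction k)
    case (Suc k)
    have "s 0 * \<rho> ^ Suc k \<le> \<rho> * s k" using Suc \<rho> by (simp add: mult.left_commute)
    then show ?case using step[of k] by linarith
  qed simp
  define t where "t = inverse \<rho>"
  have t: "\<bar>t\<bar> < 1" "0 < t" using \<rho> by (auto simp: t_def field_simps)
  have "(\<lambda>k. A * t ^ k + B * (real k * t ^ k)) \<longlonglongrightarrow> A * 0 + B * 0"
    using t by (intro tendsto_add tendsto_mult tendsto_const LIMSEQ_power_zero powser_times_n_limit_0) auto
  moreover have "s 0 \<le> A * t ^ k + B * (real k * t ^ k)" for k
  proof -
    have "s 0 * \<rho> ^ k * t ^ k \<le> (A + B * real k) * t ^ k"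
      using geo[of k] growth[of k] t by (intro mult_right_mono) auto
    then show ?thesis using \<rho> by (simp add: t_def power_inverse algebra_simps)
  qed
  ultimately have "s 0 \<le> A * 0 + B * 0"
    by (intro LIMSEQ_le_const) auto
  with pos0 show False by simp
qed

lemma polarization:
  fixes p q r s :: "'a::real_inner"
  shows "inner (p - q) (r - s)
    = - ((norm (p - r))\<^sup>2 - (norm (p - s))\<^sup>2 - (norm (q - r))\<^sup>2 + (norm (q - s))\<^sup>2) / 2"
  by (simp add: power2_norm_eq_inner inner_diff_left inner_diff_right inner_commute field_simps)

context regular_tree_graph
begin

definition nbr_avg :: "('v \<Rightarrow> 'a::real_vector) \<Rightarrow> 'v \<Rightarrow> 'a"
  where "nbr_avg F x = (1 / (real q + 1)) *\<^sub>R (\<Sum>y | adj x y. F y)"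

lemma laplace_eq: "laplace q adj F x = nbr_avg F x - F x"
  by (simp add: laplace_def nbr_avg_def)

lemma nbr_avg_const [simp]: "nbr_avg (\<lambda>_. c) x = c"
proof -
  have "(\<Sum>y | adj x y. c) = (real q + 1) *\<^sub>R c"
    by (simp add: card_nbrs sum_constant_scaleR add.commute del: sum_constant)
  then show ?thesis by (simp add: nbr_avg_def)
qed

lemma nbr_avg_diff: "nbr_avg (\<lambda>y. F y - H y) x = nbr_avg F x - nbr_avg H x"
  by (simp add: nbr_avg_def sum_subtractf scaleR_diff_right)

lemma nbr_avg_mult: "nbr_avg (\<lambda>y. c * F y) x = (c::real) * nbr_avg F x"
  by (simp add: nbr_avg_def sum_distrib_left[symmetric])

lemma inner_nbr_avg: "inner (nbr_avg F x) v = nbr_avg (\<lambda>y. inner (F y) v) x"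
  by (simp add: nbr_avg_def inner_sum_left)

lemma norm_nbr_avg_le:
  fixes F :: "'v \<Rightarrow> 'a::real_normed_vector"
  assumes "\<And>y. adj x y \<Longrightarrow> norm (F y) \<le> c"
  shows "norm (nbr_avg F x) \<le> c"
proof -
  have "norm (\<Sum>y | adj x y. F y) \<le> (\<Sum>y | adj x y. c)"
    using assms by (intro sum_norm_le) auto
  also have "\<dots> = (real q + 1) * c" by (simp add: card_nbrs)
  finally show ?thesis by (simp add: nbr_avg_def field_simps)
qed

definition radial_avg :: "(nat \<Rightarrow> real) \<Rightarrow> nat \<Rightarrow> real"
  where "radial_avg \<kappa> n =
    (case n of 0 \<Rightarrow> \<kappa> 1 | Suc m \<Rightarrow> (real q * \<kappa> (Suc n) + \<kappa> m) / (real q + 1))"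

lemma nbr_sum:
  fixes f :: "nat \<Rightarrow> 'a::real_vector"
  assumes "x \<noteq> z"
  shows "(\<Sum>y | adj x y. f (d z y)) = real q *\<^sub>R f (Suc (d z x)) + f (d z x - 1)"
proof -
  obtain p where p: "adj x p" "d z x = Suc (d z p)"
    using assms by (rule closer_exists)
  have "(\<Sum>y | adj x y. f (d z y)) = f (d z p) + (\<Sum>y\<in>{y. adj x y} - {p}. f (d z y))"
    using p finite_nbrs by (subst sum.remove[of _ p]) auto
  also have "(\<Sum>y\<in>{y. adj x y} - {p}. f (d z y)) = (\<Sum>y\<in>{y. adj x y} - {p}. f (Suc (d z x)))"
    using farther[OF p(1) _ p(2)] by (intro sum.cong) auto
  also have "\<dots> = real q *\<^sub>R f (Suc (d z x))"
    using p finite_nbrs by (simp add: card_Diff_singleton card_nbrs sum_constant_scaleR)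
  finally show ?thesis using p by (simp add: add.commute)
qed

text \<open>
  Averaging a function of the distance from \<open>z\<close> gives a function of the distance from \<open>z\<close>. Since
  the distance is symmetric, it does not matter which variable of a radial kernel is averaged.
\<close>

lemma nbr_avg_radial: "nbr_avg (\<lambda>y. \<kappa> (d z y)) x = radial_avg \<kappa> (d z x)"
proof (cases "x = z")
  case True
  have "(\<Sum>y | adj x y. \<kappa> (d z y)) = (\<Sum>y | adj x y. \<kappa> 1)"
    using dist_adj True by (intro sum.cong) auto
  then have "nbr_avg (\<lambda>y. \<kappa> (d z y)) x = nbr_avg (\<lambda>_. \<kappa> 1) x"
    by (simp only: nbr_avg_def)
  then show ?thesis using True by (simp add: radial_avg_def)
next
  case False
  then obtain m where "d z x = Suc m" by (cases "d z x") auto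
  then show ?thesis
    by (simp add: nbr_avg_def radial_avg_def nbr_sum[OF False, of \<kappa>])
qed

text \<open>
  The functions \<open>inner (F x) v\<close> and \<open>f x\<close> differ by a constant, which averaging preserves.
\<close>

lemma inner_nbr_avg_diff:
  assumes "\<And>x y. inner (F x - F y) v = f x - f y"
  shows "inner (nbr_avg F x - nbr_avg F y) v = nbr_avg f x - nbr_avg f y"
proof -
  define c where "c = inner (F x) v - f x"
  have F: "inner (F z) v = f z - (- c)" for z
    using assms[of z x] by (simp add: c_def inner_diff_left)
  show ?thesis
    unfolding inner_diff_left inner_nbr_avg F nbr_avg_diff by simp
qed

context
  fixes F :: "'v \<Rightarrow> 'a::real_inner" and a :: "nat \<Rightarrow> real"
  assumes radial: "\<And>x y. (norm (F x - F y))\<^sup>2 = a (d x y)"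
begin

abbreviation iter :: "nat \<Rightarrow> 'v \<Rightarrow> 'a"
  where "iter k \<equiv> (nbr_avg ^^ k) F"

text \<open>
  Each averaging of one of the maps averages the kernel in the corresponding variable, and a
  radial kernel does not distinguish its variables. So the right-hand side depends on \<open>j\<close> and \<open>k\<close>
  only through their sum.
\<close>

lemma inner_iter:
  "inner (iter j x - iter j y) (iter k z - iter k w) =
    (let \<kappa> = (radial_avg ^^ (j + k)) a
     in - (\<kappa> (d x z) - \<kappa> (d x w) - \<kappa> (d y z) + \<kappa> (d y w)) / 2)"
proof (induction k arbitrary: x y z w)
  case 0
  show ?case
  proof (induction j arbitrary: x y z w)
    case 0
    show ?case by (simp add: polarization radial)
  next
    case (Suc j)
    let ?\<kappa> = "(radial_avg ^^ j) a"
    let ?f = "\<lambda>x. (- 1 / 2) * (?\<kappa> (d z x) - ?\<kappa> (d w x))"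
    have "inner (iter j x - iter j y) (iter 0 z - iter 0 w) = ?f x - ?f y" for x y
      using Suc[of x y z w] by (simp add: Let_def dist_sym[of x] dist_sym[of y] field_simps)
    from inner_nbr_avg_diff[where f = ?f, OF this, of x y]
    have "inner (iter (Suc j) x - iter (Suc j) y) (iter 0 z - iter 0 w) = nbr_avg ?f x - nbr_avg ?f y"
      by simp
    then show ?case
      unfolding nbr_avg_mult nbr_avg_diff nbr_avg_radial
      by (simp add: Let_def dist_sym[of x] dist_sym[of y] field_simps)
  qed
next
  case (Suc k)
  let ?\<kappa> = "(radial_avg ^^ (j + k)) a"
  let ?f = "\<lambda>z. (- 1 / 2) * (?\<kappa> (d x z) - ?\<kappa> (d y z))"
  have "inner (iter k z - iter k w) (iter j x - iter j y) = ?f z - ?f w" for z w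
    using Suc[of x y z w] by (simp add: Let_def inner_commute field_simps)
  from inner_nbr_avg_diff[where f = ?f, OF this, of z w]
  have "inner (iter j x - iter j y) (iter (Suc k) z - iter (Suc k) w) = nbr_avg ?f z - nbr_avg ?f w"
    by (simp add: inner_commute)
  then show ?case
    unfolding nbr_avg_mult nbr_avg_diff nbr_avg_radial
    by (simp add: Let_def inner_commute field_simps)
qed

lemma inner_iter_same:
  "inner (iter j x - iter j y) (iter k x - iter k y) =
    (radial_avg ^^ (j + k)) a (d x y) - (radial_avg ^^ (j + k)) a 0"
  unfolding inner_iter by (simp add: Let_def dist_sym[of y x])

text \<open>
  The linear growth of the iterated differences rests on this bound, uniform in \<open>k\<close>: the
  displacement of one more average is the average of the previous displacement.
\<close>

lemma norm_iter_step: "norm (iter (Suc k) x - iter k x) \<le> sqrt (a 1)"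
proof (induction k arbitrary: x)
  case 0
  have "norm (F y - F x) \<le> sqrt (a 1)" if "adj x y" for y
    using radial[of y x] dist_adj[OF that] by (simp add: dist_sym[of y x] real_le_rsqrt)
  then have "norm (nbr_avg (\<lambda>y. F y - F x) x) \<le> sqrt (a 1)"
    by (rule norm_nbr_avg_le)
  then show ?case by (simp add: nbr_avg_diff)
next
  case (Suc k)
  have "norm (nbr_avg (\<lambda>y. iter (Suc k) y - iter k y) x) \<le> sqrt (a 1)"
    using Suc by (intro norm_nbr_avg_le)
  then show ?case unfolding nbr_avg_diff by simp
qed

lemma norm_iter_growth:
  "norm (iter k x - iter k y) \<le> norm (F x - F y) + 2 * sqrt (a 1) * real k"
proof (induction k)
  case (Suc k)
  have "norm (u - v) \<le> norm (u - u') + norm (u' - v') + norm (v - v')" for u v u' v' :: 'a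
    using norm_triangle_ineq[of "u - u'" "u' - v'"] norm_triangle_ineq4[of "u - v'" "v - v'"] by simp
  from this[of "iter (Suc k) x" "iter (Suc k) y" "iter k x" "iter k y"] show ?case
    using Suc norm_iter_step[of k x] norm_iter_step[of k y] by (simp add: algebra_simps)
qed simp

text \<open>
  A spectral statement in disguise: the symmetric operator induced by averaging on differences has
  moments of at most polynomial growth, hence norm at most 1. The log-convexity argument replaces
  the spectral theorem.
\<close>

lemma nbr_avg_contracts: "norm (nbr_avg F x - nbr_avg F y) \<le> norm (F x - F y)"
proof -
  let ?u = "\<lambda>k. iter k x - iter k y"
  have "norm (?u 1) \<le> norm (?u 0)"
  proof (rule log_convex_linear_growth)
    fix k
    show "norm (?u k) \<le> norm (F x - F y) + 2 * sqrt (a 1) * real k"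
      by (rule norm_iter_growth)
    have "(norm (?u (Suc k)))\<^sup>2 = inner (?u k) (?u (Suc (Suc k)))"
      unfolding power2_norm_eq_inner inner_iter_same by simp
    also have "\<dots> \<le> norm (?u k) * norm (?u (Suc (Suc k)))"
      by (rule norm_cauchy_schwarz)
    finally show "(norm (?u (Suc k)))\<^sup>2 \<le> norm (?u k) * norm (?u (Suc (Suc k)))" .
  qed simp
  then show ?thesis by simp
qed

lemma radial_zero: "a 0 = 0"
  using radial[of undefined undefined] by simp

lemma distance_attained: "\<exists>x y. d x y = n"
  using extend_geodesic[of x x n for x] by auto

text \<open>
  The contraction, tested against \<open>F x - F y\<close> for \<open>x\<close> and \<open>y\<close> at distance \<open>n + 1\<close>.
\<close>

lemma radial_step_le: "real q * a (Suc (Suc n)) + a n \<le> (real q + 1) * (a (Suc n) + a 1)"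
proof -
  obtain x y where xy: "d x y = Suc n" using distance_attained by blast
  have "inner (F x - F y) (nbr_avg F x - nbr_avg F y) \<le> norm (F x - F y) * norm (nbr_avg F x - nbr_avg F y)"
    by (rule norm_cauchy_schwarz)
  also have "\<dots> \<le> norm (F x - F y) * norm (F x - F y)"
    by (intro mult_left_mono nbr_avg_contracts) simp
  also have "\<dots> = a (Suc n)"
    using radial[of x y] xy by (simp add: power2_eq_square)
  finally have "radial_avg a (Suc n) - radial_avg a 0 \<le> a (Suc n)"
    using inner_iter_same[of 0 x y 1] xy by simp
  then show ?thesis by (simp add: radial_avg_def field_simps)
qed

text \<open>
  For harmonic \<open>F\<close> the averaged and the original differences coincide, so the estimate becomes an
  identity.
\<close>

lemma radial_step_eq:
  assumes "harmonic q adj F"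
  shows "real q * a (Suc (Suc n)) + a n = (real q + 1) * (a (Suc n) + a 1)"
proof -
  obtain x y where xy: "d x y = Suc n" using distance_attained by blast
  have avg: "nbr_avg F z = F z" for z
    using assms unfolding harmonic_def laplace_eq by simp
  have "radial_avg a (Suc n) - radial_avg a 0 = a (Suc n) - a 0"
    using inner_iter_same[of 0 x y 1] inner_iter_same[of 0 x y 0] xy by (simp add: avg)
  then show ?thesis by (simp add: radial_avg_def radial_zero field_simps)
qed

end

end


section \<open>The growth bound\<close>

text \<open>
  Up to the positive factor \<open>c\<close>, each increment is at most the previous one, and the first one is
  \<open>0\<close>.
\<close>

lemma recurrence_nonpos:
  fixes e :: "nat \<Rightarrow> real"
  assumes "e 0 = 0" "e 1 = 0" "c > 0"
    and step: "\<And>n. c * (e (Suc (Suc n)) - e (Suc n)) \<le> e (Suc n) - e n"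
  shows "e n \<le> 0"
proof -
  have "e (Suc n) \<le> e n" for n
  proof (induction n)
    case (Suc n)
    then have "c * (e (Suc (Suc n)) - e (Suc n)) \<le> 0" using step[of n] by linarith
    then show ?case using \<open>c > 0\<close> by (simp add: mult_le_0_iff)
  qed (use assms in simp)
  then show ?thesis
    using assms(1) lift_Suc_antimono_le[of e 0 n] by simp
qed

context regular_tree_graph
begin

text \<open>
  The right-hand side of the bound for a map with squared increment \<open>c\<close> along edges: the solution
  of the recurrence \<open>q u(n+2) + u(n) = (q+1) (u(n+1) + c)\<close> with \<open>u 0 = 0\<close> and \<open>u 1 = c\<close>.
\<close>

definition profile :: "real \<Rightarrow> nat \<Rightarrow> real"
  where "profile c n = (real q + 1) * c / (real q - 1) * real n - 2 * real q * c / (real q - 1)\<^sup>2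
    + 2 * real q * c / (real q - 1)\<^sup>2 / real q ^ n"

lemma profile_0: "profile c 0 = 0"
  by (simp add: profile_def)

lemma profile_1: "profile c 1 = c"
  using q_ge_2 by (simp add: profile_def divide_simps power2_eq_square) (simp add: algebra_simps)

lemma profile_step:
  "real q * profile c (Suc (Suc n)) + profile c n = (real q + 1) * (profile c (Suc n) + c)"
proof -
  define A where "A = (real q + 1) * c / (real q - 1)"
  define B where "B = 2 * real q * c / (real q - 1)\<^sup>2"
  have q: "real q > 1" using q_ge_2 by simp
  have A: "(real q - 1) * A = (real q + 1) * c" using q by (simp add: A_def)
  have p: "profile c n = A * real n - B + B / real q ^ n" for n
    by (simp add: profile_def A_def B_def)
  have 1: "real q * (B / real q ^ Suc (Suc n)) + B / real q ^ n = (real q + 1) * (B / real q ^ Suc n)"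
    using q by (simp add: field_simps)
  have 2: "real q * (A * real (Suc (Suc n)) - B) + (A * real n - B)
      = (real q + 1) * (A * real (Suc n) - B) + (real q - 1) * A"
    by (simp add: algebra_simps)
  show ?thesis using 1 2 A unfolding p by (simp add: algebra_simps)
qed

context
  fixes F :: "'v \<Rightarrow> 'a::real_inner" and a :: "nat \<Rightarrow> real"
  assumes radial: "\<And>x y. (norm (F x - F y))\<^sup>2 = a (d x y)"
begin

lemma radial_le_profile: "a n \<le> profile (a 1) n"
proof -
  have "a n - profile (a 1) n \<le> 0"
  proof (rule recurrence_nonpos[where e = "\<lambda>n. a n - profile (a 1) n" and c = "real q"])
    fix n
    show "real q * ((a (Suc (Suc n)) - profile (a 1) (Suc (Suc n))) - (a (Suc n) - profile (a 1) (Suc n)))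
      \<le> (a (Suc n) - profile (a 1) (Suc n)) - (a n - profile (a 1) n)"
      using radial_step_le[where F = F and a = a, OF radial, of n] profile_step[of "a 1" n] by (simp add: algebra_simps)
  qed (use q_ge_2 profile_0 profile_1 radial_zero[where F = F and a = a, OF radial] in auto)
  then show ?thesis by simp
qed

lemma radial_eq_profile:
  assumes "harmonic q adj F"
  shows "a n = profile (a 1) n"
proof -
  have "profile (a 1) n - a n \<le> 0"
  proof (rule recurrence_nonpos[where e = "\<lambda>n. profile (a 1) n - a n" and c = "real q"])
    fix n
    show "real q * ((profile (a 1) (Suc (Suc n)) - a (Suc (Suc n))) - (profile (a 1) (Suc n) - a (Suc n)))
      \<le> (profile (a 1) (Suc n) - a (Suc n)) - (profile (a 1) n - a n)"
      using radial_step_eq[where F = F and a = a, OF radial assms, of n] profile_step[of "a 1" n] by (simp add: algebra_simps)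
  qed (use q_ge_2 profile_0 profile_1 radial_zero[where F = F and a = a, OF radial] in auto)
  then show ?thesis using radial_le_profile[of n] by simp
qed

end

end

lemma unitary_norm:
  assumes "unitary_map U"
  shows "norm (U v - U w) = norm (v - w)"
proof -
  have add: "U (x + y) = U x + U y" and pres: "cinner (U x) (U y) = cinner x y" for x y
    using assms by (auto simp: unitary_map_def)
  have "U v - U w = U (v - w)" using add[of "v - w" w] by simp
  then show ?thesis by (simp add: norm_eq_sqrt_inner inner_Re_cinner pres)
qed

context boundary_transitive_tree
begin

text \<open>
  Affine isometries preserve the distances between values of \<open>F\<close>, so distance transitivity
  applies.
\<close>

lemma equivariant_radial:
  fixes F :: "'v \<Rightarrow> 'h::complex_hilbert_space"
  assumes act: "affine_isometric_action adj G \<alpha>" and equi: "equivariant G \<alpha> F"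
  obtains a where "\<And>x y. (norm (F x - F y))\<^sup>2 = a (d x y)"
proof -
  have inv: "norm (F (g x) - F (g y)) = norm (F x - F y)" if g: "g \<in> G" for g x y
  proof -
    obtain \<pi> b where "unitary_rep adj G \<pi>" "\<And>v. \<alpha> g v = \<pi> g v + b g"
      using act g by (auto simp: affine_isometric_action_def)
    then show ?thesis
      using equi g unitary_norm[of "\<pi> g"] by (simp add: equivariant_def unitary_rep_def)
  qed
  define a where "a n = (SOME t. \<exists>x y. d x y = n \<and> t = (norm (F x - F y))\<^sup>2)" for n
  have "(norm (F x - F y))\<^sup>2 = a (d x y)" for x y
  proof -
    have "\<exists>x' y'. d x' y' = d x y \<and> a (d x y) = (norm (F x' - F y'))\<^sup>2"
      unfolding a_def by (rule someI_ex) blast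
    then obtain x' y' where "d x' y' = d x y" "a (d x y) = (norm (F x' - F y'))\<^sup>2" by blast
    then show ?thesis using distance_transitive[of x y x' y'] inv by metis
  qed
  then show ?thesis by (rule that)
qed

theorem equivariant_norm_bound:
  fixes F :: "'v \<Rightarrow> 'h::complex_hilbert_space"
  assumes "affine_isometric_action adj G \<alpha>" "equivariant G \<alpha> F" "F x0 = 0" "adj x0 x1"
  defines "A \<equiv> (real q + 1) * (norm (F x1))\<^sup>2 / (real q - 1)"
    and "B \<equiv> 2 * real q * (norm (F x1))\<^sup>2 / (real q - 1)\<^sup>2"
  shows "(norm (F x))\<^sup>2 \<le> A * real (d x x0) - B + B * real q powi (- int (d x x0))"
    and "harmonic q adj F \<Longrightarrow>
      (norm (F x))\<^sup>2 = A * real (d x x0) - B + B * real q powi (- int (d x x0))"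
proof -
  obtain a where a: "\<And>x y. (norm (F x - F y))\<^sup>2 = a (d x y)"
    using equivariant_radial[OF assms(1,2)] by blast
  have F: "(norm (F x))\<^sup>2 = a (d x x0)" for x
    using a[of x x0] assms(3) by simp
  have "(norm (F x1))\<^sup>2 = a 1"
    unfolding F using dist_adj[OF assms(4)] by (simp add: dist_sym[of x1])
  then have p: "profile (a 1) n = A * real n - B + B * real q powi (- int n)" for n
    by (simp add: profile_def A_def B_def power_int_minus divide_inverse)
  show "(norm (F x))\<^sup>2 \<le> A * real (d x x0) - B + B * real q powi (- int (d x x0))"
    using radial_le_profile[where F = F and a = a, OF a] unfolding F p .
  show "(norm (F x))\<^sup>2 = A * real (d x x0) - B + B * real q powi (- int (d x x0))"
    if "harmonic q adj F"
    using radial_eq_profile[where F = F and a = a, OF a that] unfolding F p .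
qed

end


section \<open>Permutation operators on \<open>\<ell>\<^sup>2\<close>\<close>

lemma sums_reindex_bij:
  fixes f :: "nat \<Rightarrow> 'a::banach"
  assumes "summable (\<lambda>n. norm (f n))" "bij \<sigma>"
  shows "(\<lambda>n. f (\<sigma> n)) sums suminf f"
proof -
  have "f sums suminf f"
    using summable_sums[OF summable_norm_cancel[OF assms(1)]] .
  then have "(f has_sum suminf f) UNIV"
    by (rule norm_summable_imp_has_sum[OF assms(1)])
  then have "((\<lambda>n. f (\<sigma> n)) has_sum suminf f) UNIV"
    using has_sum_reindex_bij_betw[OF assms(2), of f] by simp
  then show ?thesis by (rule has_sum_imp_sums)
qed

definition perm_ell2 :: "(nat \<Rightarrow> nat) \<Rightarrow> ell2 \<Rightarrow> ell2"
  where "perm_ell2 \<sigma> v = Abs_ell2 (\<lambda>n. ell2_nth v (\<sigma> n))"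

lemma nth_perm_ell2:
  assumes "bij \<sigma>"
  shows "ell2_nth (perm_ell2 \<sigma> v) n = ell2_nth v (\<sigma> n)"
proof -
  have "summable (\<lambda>n. (cmod (ell2_nth v (\<sigma> n)))\<^sup>2)"
    using sums_reindex_bij[OF _ assms, of "\<lambda>n. (cmod (ell2_nth v n))\<^sup>2"] summable_ell2_nth
    by (simp add: sums_iff)
  then show ?thesis by (simp add: perm_ell2_def Abs_ell2_inverse)
qed

lemma summable_norm_ell2_mult: "summable (\<lambda>n. norm (ell2_nth x n * cnj (ell2_nth y n)))"
proof (rule summable_comparison_test')
  show "summable (\<lambda>n. (cmod (ell2_nth x n))\<^sup>2 + (cmod (ell2_nth y n))\<^sup>2)"
    by (intro summable_add summable_ell2_nth)
  fix n
  have "0 \<le> (cmod (ell2_nth x n))\<^sup>2 + (cmod (ell2_nth y n))\<^sup>2" by simp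
  then have "cmod (ell2_nth x n) * cmod (ell2_nth y n) \<le> (cmod (ell2_nth x n))\<^sup>2 + (cmod (ell2_nth y n))\<^sup>2"
    using sum_squares_bound[of "cmod (ell2_nth x n)" "cmod (ell2_nth y n)"] by linarith
  then show "norm (norm (ell2_nth x n * cnj (ell2_nth y n)))
      \<le> (cmod (ell2_nth x n))\<^sup>2 + (cmod (ell2_nth y n))\<^sup>2"
    by (simp add: norm_mult)
qed

lemma unitary_perm_ell2:
  assumes "bij \<sigma>"
  shows "unitary_map (perm_ell2 \<sigma>)"
  unfolding unitary_map_def
proof (intro conjI allI)
  fix v w :: ell2 and c
  show "perm_ell2 \<sigma> (v + w) = perm_ell2 \<sigma> v + perm_ell2 \<sigma> w"
    "perm_ell2 \<sigma> (c *\<^sub>C v) = c *\<^sub>C perm_ell2 \<sigma> v"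
    by (rule ell2_eqI; simp add: nth_perm_ell2[OF assms] ell2_nth_simps)+
  show "cinner (perm_ell2 \<sigma> v) (perm_ell2 \<sigma> w) = cinner v w"
    using sums_reindex_bij[OF summable_norm_ell2_mult assms, of v w]
    by (simp add: cinner_ell2.rep_eq nth_perm_ell2[OF assms] sums_iff)
next
  have "perm_ell2 \<sigma> (perm_ell2 (inv_into UNIV \<sigma>) v) = v" for v
    by (rule ell2_eqI)
      (simp add: nth_perm_ell2 assms bij_imp_bij_inv bij_is_inj)
  then show "surj (perm_ell2 \<sigma>)" by (metis surjI)
qed

lemma ell2_tail:
  assumes "e > 0"
  obtains N u where "norm (v - u) < e" "\<And>n. ell2_nth u n = (if n < N then ell2_nth v n else 0)"
proof -
  let ?f = "\<lambda>n. (cmod (ell2_nth v n))\<^sup>2"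
  have "\<exists>N. \<forall>n\<ge>N. norm (\<Sum>i. ?f (i + n)) < e\<^sup>2"
    by (rule suminf_exist_split) (use assms summable_ell2_nth in auto)
  then obtain N where N: "norm (\<Sum>i. ?f (i + N)) < e\<^sup>2" by blast
  define u where "u = Abs_ell2 (\<lambda>n. if n < N then ell2_nth v n else 0)"
  have "summable (\<lambda>n. (cmod (if n < N then ell2_nth v n else 0))\<^sup>2)"
    by (rule summable_finite[of "{..<N}"]) auto
  then have u: "ell2_nth u n = (if n < N then ell2_nth v n else 0)" for n
    by (simp add: u_def Abs_ell2_inverse)
  have nth: "ell2_nth (v - u) n = (if n < N then 0 else ell2_nth v n)" for n
    by (simp add: ell2_nth_simps u)
  have "(norm (v - u))\<^sup>2 = (\<Sum>i. (cmod (ell2_nth (v - u) (i + N)))\<^sup>2)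
      + (\<Sum>i<N. (cmod (ell2_nth (v - u) i))\<^sup>2)"
    unfolding norm_ell2_power2 by (rule suminf_split_initial_segment[OF summable_ell2_nth])
  also have "\<dots> = (\<Sum>i. ?f (i + N))" by (simp add: nth)
  also have "\<dots> < e\<^sup>2" using N by simp
  finally have "norm (v - u) < e" using assms by (simp add: power_less_imp_less_base)
  then show ?thesis using u that by blast
qed

lemma ell2_nth_sum: "ell2_nth (\<Sum>y\<in>A. f y) n = (\<Sum>y\<in>A. ell2_nth (f y) n)"
  by (induction A rule: infinite_finite_induct) (auto simp: ell2_nth_simps)

text \<open>
  Basic neighbourhoods of \<open>g\<close> consist of the maps agreeing with \<open>g\<close> on a finite set of vertices.
\<close>

lemma continuous_map_pointwise:
  fixes f :: "('v \<Rightarrow> 'v) \<Rightarrow> 'a::metric_space"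
  assumes "G \<subseteq> graph_aut adj"
    and close: "\<And>g e. g \<in> G \<Longrightarrow> e > 0 \<Longrightarrow>
      \<exists>S. finite S \<and> (\<forall>h\<in>G. (\<forall>s\<in>S. h s = g s) \<longrightarrow> dist (f h) (f g) < e)"
  shows "continuous_map (subtopology (aut_topology adj) G) euclidean f"
proof -
  let ?P = "product_topology (\<lambda>_::'v. discrete_topology (UNIV :: 'v set)) UNIV"
  have top: "subtopology (aut_topology adj) G = subtopology ?P G"
    using assms(1) by (simp add: aut_topology_def subtopology_subtopology Int_absorb1)
  have space: "topspace (subtopology ?P G) = G"
    by auto
  show ?thesis
    unfolding top continuous_map_def
  proof (intro conjI allI impI)
    fix U :: "'a set" assume "openin euclidean U"
    then have U: "open U" by simp
    show "openin (subtopology ?P G) {g \<in> topspace (subtopology ?P G). f g \<in> U}"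
    proof (subst openin_subopen, intro ballI)
      fix g assume "g \<in> {g \<in> topspace (subtopology ?P G). f g \<in> U}"
      then have g: "g \<in> G" "f g \<in> U" unfolding space by auto
      then obtain e where e: "e > 0" "\<And>z. dist z (f g) < e \<Longrightarrow> z \<in> U"
        using U unfolding open_dist by blast
      obtain S where S: "finite S" "\<And>h. h \<in> G \<Longrightarrow> (\<And>s. s \<in> S \<Longrightarrow> h s = g s) \<Longrightarrow> dist (f h) (f g) < e"
        using close[OF g(1) e(1)] by blast
      define N where "N = (\<Pi>\<^sub>E i\<in>UNIV. if i \<in> S then {g i} else UNIV)"
      have "openin ?P N"
        unfolding N_def
        by (rule product_topology_basis) (auto intro: finite_subset[OF _ S(1)])
      then have "openin (subtopology ?P G) (N \<inter> G)"
        by (auto simp: openin_subtopology)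
      moreover have "g \<in> N \<inter> G" using g by (auto simp: N_def PiE_def Pi_def extensional_def)
      moreover have "N \<inter> G \<subseteq> {g \<in> topspace (subtopology ?P G). f g \<in> U}"
      proof
        fix h assume h: "h \<in> N \<inter> G"
        then have "h s = g s" if "s \<in> S" for s
          using that by (auto simp: N_def PiE_def Pi_def split: if_splits)
        with h show "h \<in> {g \<in> topspace (subtopology ?P G). f g \<in> U}"
          unfolding space using S(2)[of h] e(2) by auto
      qed
      ultimately show "\<exists>T. openin (subtopology ?P G) T \<and> g \<in> T \<and>
          T \<subseteq> {g \<in> topspace (subtopology ?P G). f g \<in> U}"
        by blast
    qed
  qed simp
qed


section \<open>Harmonic measures of half-trees\<close>

context regular_tree_graph
begin

text \<open>
  Up to the factor \<open>q + 1\<close>, the probability that simple random walk started at \<open>x\<close> ends in the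
  half-tree of vertices nearer to \<open>b\<close> than to \<open>a\<close>: the walk reaches \<open>a\<close> from distance \<open>k\<close> with
  probability \<open>q\<^sup>-\<^sup>k\<close>, and from \<open>a\<close> it ends behind \<open>b\<close> with probability \<open>1 / (q + 1)\<close>.
\<close>

definition halftree_measure :: "'v \<Rightarrow> 'v \<Rightarrow> 'v \<Rightarrow> real"
  where "halftree_measure a b x = (if d a x < d b x then 1 / real q ^ d a x else real q + 1 - 1 / real q ^ d b x)"

text \<open>
  The walk ends on exactly one of the two sides.
\<close>

lemma halftree_measure_flip:
  assumes "adj a b"
  shows "halftree_measure b a x = real q + 1 - halftree_measure a b x"
  by (cases rule: dist_edge_cases[OF assms, of x]) (simp_all add: halftree_measure_def)

text \<open>
  One neighbour \<open>z\<close> of \<open>x\<close> is special: \<open>b\<close> if \<open>x = a\<close>, and otherwise the neighbour nearer to \<open>a\<close>.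
  The other \<open>q\<close> neighbours lie one step further from \<open>a\<close> on the same side, and together contribute
  \<open>1 / q\<^sup>k\<close>, where \<open>k\<close> is the distance from \<open>a\<close> to \<open>x\<close>.
\<close>

lemma halftree_measure_harmonic_near:
  assumes ab: "adj a b" and side: "d a x < d b x"
  shows "nbr_avg (halftree_measure a b) x = halftree_measure a b x"
proof -
  have q: "real q > 0" using q_ge_2 by simp
  have other: "d a y < d b y" if "adj x y" "\<not> (x = a \<and> y = b)" for y
  proof (rule ccontr)
    assume "\<not> d a y < d b y"
    then have "d b y < d a y"
      by (cases rule: dist_edge_cases[OF ab, of y]) simp_all
    then show False using only_edge_between_halftrees[OF ab that(1) side] that(2) by blast
  qed
  obtain z where z: "adj x z" "\<not> (x = a \<and> z \<noteq> b)"
    "halftree_measure a b z = (if x = a then real q else real q / real q ^ d a x)"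
    "\<And>y. adj x y \<Longrightarrow> y \<noteq> z \<Longrightarrow> d a y = Suc (d a x) \<and> \<not> (x = a \<and> y = b)"
  proof (cases "x = a")
    case True
    show ?thesis
    proof (rule that[of b])
      show "halftree_measure a b b = (if x = a then real q else real q / real q ^ d a x)"
        using dist_adj[OF ab] True by (simp add: halftree_measure_def)
      show "d a y = Suc (d a x) \<and> \<not> (x = a \<and> y = b)" if "adj x y" "y \<noteq> b" for y
        using that True dist_adj[of x y] by simp
    qed (use True ab in simp_all)
  next
    case False
    then obtain p where p: "adj x p" "d a x = Suc (d a p)" by (rule closer_exists)
    show ?thesis
    proof (rule that[of p])
      show "halftree_measure a b p = (if x = a then real q else real q / real q ^ d a x)"
        using other[OF p(1)] False p q by (simp add: halftree_measure_def)
      show "d a y = Suc (d a x) \<and> \<not> (x = a \<and> y = b)" if "adj x y" "y \<noteq> p" for y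
        using farther[OF p(1) that(1) p(2) that(2)] False by simp
    qed (use False p(1) in simp_all)
  qed
  have "(\<Sum>y | adj x y. halftree_measure a b y) = halftree_measure a b z + (\<Sum>y\<in>{y. adj x y} - {z}. halftree_measure a b y)"
    using z finite_nbrs by (subst sum.remove[of _ z]) auto
  also have "(\<Sum>y\<in>{y. adj x y} - {z}. halftree_measure a b y) = (\<Sum>y\<in>{y. adj x y} - {z}. 1 / real q ^ Suc (d a x))"
  proof (intro sum.cong refl)
    fix y assume "y \<in> {y. adj x y} - {z}"
    then have "d a y = Suc (d a x)" "d a y < d b y"
      using z(4)[of y] other[of y] by auto
    then show "halftree_measure a b y = 1 / real q ^ Suc (d a x)" by (simp add: halftree_measure_def)
  qed
  also have "\<dots> = 1 / real q ^ d a x"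
    using z finite_nbrs q by (simp add: card_Diff_singleton card_nbrs)
  finally show ?thesis
    using z(3) side q by (cases "x = a") (auto simp: nbr_avg_def halftree_measure_def field_simps)
qed

lemma halftree_measure_harmonic:
  assumes ab: "adj a b"
  shows "nbr_avg (halftree_measure a b) x = halftree_measure a b x"
proof (cases "d a x < d b x")
  case True
  then show ?thesis by (rule halftree_measure_harmonic_near[OF ab])
next
  case False
  then have "d b x < d a x"
    by (cases rule: dist_edge_cases[OF ab, of x]) simp_all
  then have "nbr_avg (halftree_measure b a) x = halftree_measure b a x"
    by (rule halftree_measure_harmonic_near[OF adj_sym[OF ab]])
  moreover have "halftree_measure b a = (\<lambda>y. (real q + 1) - halftree_measure a b y)"
    by (rule ext) (simp add: halftree_measure_flip[OF ab])
  ultimately show ?thesis by (simp add: nbr_avg_diff)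
qed

lemma halftree_measure_diff_near:
  assumes ab: "adj a b" and xy: "adj x y" and side: "d a x < d b x"
  shows "\<bar>halftree_measure a b x - halftree_measure a b y\<bar> \<le> (real q)\<^sup>2 / real q ^ d a x"
proof -
  have q: "real q \<ge> 2" using q_ge_2 by simp
  have pw: "1 / real q ^ m \<le> (real q)\<^sup>2 / real q ^ k" if "k \<le> m + 2" for m k
  proof -
    have "real q ^ k \<le> real q ^ (m + 2)" using that q by (intro power_increasing) auto
    then show ?thesis using q by (simp add: divide_simps power_add power2_eq_square mult_ac)
  qed
  show ?thesis
  proof (cases "d a y < d b y")
    case True
    have "1 / real q ^ d a y \<le> (real q)\<^sup>2 / real q ^ d a x"
      using dist_adj_le[OF adj_sym[OF xy], of a] by (intro pw) simp
    moreover have "1 / real q ^ d a x \<le> (real q)\<^sup>2 / real q ^ d a x"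
      by (intro pw) simp
    moreover have "0 \<le> 1 / real q ^ d a y" "0 \<le> 1 / real q ^ d a x" by simp_all
    ultimately show ?thesis using True side unfolding halftree_measure_def by (simp only: if_True)
  next
    case False
    then have "d b y < d a y"
      by (cases rule: dist_edge_cases[OF ab, of y]) simp_all
    from only_edge_between_halftrees[OF ab xy side this] have "x = a" "y = b" by auto
    then have "\<bar>halftree_measure a b x - halftree_measure a b y\<bar> = real q - 1"
      using dist_adj[OF ab] dist_adj[OF adj_sym[OF ab]] q by (simp add: halftree_measure_def)
    also have "\<dots> \<le> real q" by simp
    also have "\<dots> \<le> (real q)\<^sup>2"
      using q by (intro self_le_power) auto
    finally show ?thesis using \<open>x = a\<close> by simp
  qed
qed

text \<open>
  The dependence on the starting point decays geometrically with the distance to the edge. The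
  constant \<open>q\<^sup>3\<close> absorbs the change of this distance when \<open>x\<close> is replaced by \<open>y\<close> or \<open>a\<close> by \<open>b\<close>,
  and the jump across the edge itself.
\<close>

lemma halftree_measure_diff:
  assumes ab: "adj a b" and xy: "adj x y"
  shows "\<bar>halftree_measure a b x - halftree_measure a b y\<bar> \<le> real q ^ 3 / real q ^ d a x"
proof (cases "d a x < d b x")
  case True
  have "(real q)\<^sup>2 \<le> real q ^ 3" using q_ge_2 by (intro power_increasing) auto
  then have "(real q)\<^sup>2 / real q ^ d a x \<le> real q ^ 3 / real q ^ d a x"
    by (intro divide_right_mono) auto
  then show ?thesis using halftree_measure_diff_near[OF ab xy True] by linarith
next
  case False
  then have side: "d a x = Suc (d b x)"
    by (cases rule: dist_edge_cases[OF ab, of x]) simp_all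
  then have "\<bar>halftree_measure b a x - halftree_measure b a y\<bar> \<le> (real q)\<^sup>2 / real q ^ d b x"
    by (intro halftree_measure_diff_near[OF adj_sym[OF ab] xy]) simp
  also have "\<dots> = real q ^ 3 / real q ^ d a x"
    using q_ge_2 by (simp add: side power2_eq_square power3_eq_cube)
  finally show ?thesis
    unfolding halftree_measure_flip[OF ab] by (simp add: abs_minus_commute)
qed

text \<open>
  At most \<open>(q + 1)\<^sup>k\<^sup>+\<^sup>1\<close> oriented edges start at distance \<open>k\<close> from \<open>x\<close>, so a geometric series
  with ratio \<open>(q + 1) * t\<close> dominates.
\<close>

lemma edge_sum_bounded:
  fixes t :: real
  assumes t: "0 < t" "(real q + 1) * t < 1" and B: "finite B"
  shows "(\<Sum>e\<in>B. if adj (fst e) (snd e) then t ^ d x (fst e) else 0)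
    \<le> (real q + 1) / (1 - (real q + 1) * t)"
proof -
  let ?r = "(real q + 1) * t"
  have "finite ((\<lambda>e. d x (fst e)) ` B)" by (rule finite_imageI[OF B])
  then obtain N where "\<forall>m\<in>(\<lambda>e. d x (fst e)) ` B. m \<le> N"
    unfolding finite_nat_set_iff_bounded_le ..
  then have N: "d x (fst e) \<le> N" if "e \<in> B" for e using that by simp
  have ball: "{a. d x a \<le> N} = (\<Union>k\<le>N. {a. d x a = k})" by auto
  have fin: "finite {a. d x a \<le> N}" unfolding ball using sphere by blast
  let ?C = "SIGMA a:{a. d x a \<le> N}. {b. adj a b}"
  have finC: "finite ?C" using fin finite_nbrs by blast
  have "(\<Sum>e\<in>B. if adj (fst e) (snd e) then t ^ d x (fst e) else 0)
      = (\<Sum>e\<in>{e\<in>B. adj (fst e) (snd e)}. t ^ d x (fst e))"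
    using B by (simp add: sum.inter_filter)
  also have "\<dots> \<le> (\<Sum>e\<in>?C. t ^ d x (fst e))"
    using N t(1) by (intro sum_mono2[OF finC]) auto
  also have "\<dots> = (\<Sum>a | d x a \<le> N. \<Sum>b | adj a b. t ^ d x a)"
    using fin finite_nbrs by (subst sum.Sigma) (auto simp: case_prod_beta)
  also have "\<dots> = (real q + 1) * (\<Sum>a | d x a \<le> N. t ^ d x a)"
    by (simp add: card_nbrs sum_distrib_left add.commute)
  also have "(\<Sum>a | d x a \<le> N. t ^ d x a) = (\<Sum>k\<le>N. \<Sum>a\<in>{a\<in>{a. d x a \<le> N}. d x a = k}. t ^ d x a)"
    using fin by (intro sum.group[symmetric]) auto
  also have "\<dots> \<le> (\<Sum>k\<le>N. ?r ^ k)"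
  proof (rule sum_mono)
    fix k assume "k \<in> {..N}"
    then have "{a\<in>{a. d x a \<le> N}. d x a = k} = {a. d x a = k}" by auto
    then have "(\<Sum>a\<in>{a\<in>{a. d x a \<le> N}. d x a = k}. t ^ d x a) = real (card {a. d x a = k}) * t ^ k"
      by simp
    also have "\<dots> \<le> real ((q + 1) ^ k) * t ^ k"
      using sphere[of x k] t(1) by (intro mult_right_mono) (simp_all del: of_nat_power)
    finally show "(\<Sum>a\<in>{a\<in>{a. d x a \<le> N}. d x a = k}. t ^ d x a) \<le> ?r ^ k"
      by (simp add: power_mult_distrib add.commute)
  qed
  also have "(\<Sum>k\<le>N. ?r ^ k) \<le> (\<Sum>k. ?r ^ k)"
    using t by (intro sum_le_suminf summable_geometric) auto
  also have "\<dots> = 1 / (1 - ?r)"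
    using t by (intro suminf_geometric) auto
  finally show ?thesis by (simp add: mult_left_mono)
qed

text \<open>
  Coordinates of \<open>\<ell>\<^sup>2\<close> are numbered by natural numbers, so all pairs of vertices are enumerated;
  pairs that are not edges get the coordinate \<open>0\<close>.
\<close>

definition pair_at :: "nat \<Rightarrow> 'v \<times> 'v"
  where "pair_at = from_nat_into UNIV"

definition pair_index :: "'v \<times> 'v \<Rightarrow> nat"
  where "pair_index = to_nat_on UNIV"

lemma countable_pairs: "countable (UNIV :: ('v \<times> 'v) set)"
  using countable_SIGMA[of UNIV "\<lambda>_. UNIV"] countable_vertices by simp

lemma infinite_pairs: "infinite (UNIV :: ('v \<times> 'v) set)"
  using infinite_vertices by (simp add: finite_prod)

lemma pair_at_index [simp]: "pair_at (pair_index e) = e"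
  by (simp add: pair_at_def pair_index_def countable_pairs)

lemma pair_index_at [simp]: "pair_index (pair_at n) = n"
  by (simp add: pair_at_def pair_index_def countable_pairs infinite_pairs)

definition coord :: "'v \<Rightarrow> nat \<Rightarrow> real"
  where "coord x n = (case pair_at n of (a, b) \<Rightarrow> if adj a b then halftree_measure a b x else 0)"

lemma coord_harmonic: "nbr_avg (\<lambda>y. coord y n) x = coord x n"
proof -
  obtain a b where e: "pair_at n = (a, b)" by (cases "pair_at n")
  show ?thesis
    using halftree_measure_harmonic[of a b x] by (cases "adj a b") (simp_all add: coord_def e)
qed

text \<open>
  The squared differences are at most \<open>q\<^sup>6 * t\<^sup>k\<close> with \<open>t = 1 / q\<^sup>2\<close>, and \<open>(q + 1) * t < 1\<close>.
\<close>

lemma coord_summable_adj: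
  assumes xy: "adj x y"
  shows "summable (\<lambda>n. (coord x n - coord y n)\<^sup>2)"
proof -
  define t where "t = 1 / (real q)\<^sup>2"
  have q: "real q \<ge> 2" using q_ge_2 by simp
  have "2 * real q \<le> (real q)\<^sup>2" using q by (simp add: power2_eq_square)
  then have "real q + 1 < (real q)\<^sup>2" using q by linarith
  then have t: "0 < t" "(real q + 1) * t < 1" using q by (auto simp: t_def field_simps)
  let ?w = "\<lambda>e. if adj (fst e) (snd e) then t ^ d x (fst e) else (0::real)"
  have bound: "(coord x n - coord y n)\<^sup>2 \<le> real q ^ 6 * ?w (pair_at n)" for n
  proof -
    obtain a b where e: "pair_at n = (a, b)" by (cases "pair_at n")
    show ?thesis
    proof (cases "adj a b")
      case True
      have "(coord x n - coord y n)\<^sup>2 = \<bar>halftree_measure a b x - halftree_measure a b y\<bar>\<^sup>2"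
        using True by (simp add: coord_def e)
      also have "\<dots> \<le> (real q ^ 3 / real q ^ d a x)\<^sup>2"
        using halftree_measure_diff[OF True xy] by (intro power_mono) auto
      also have "\<dots> = real q ^ 6 * t ^ d x a"
        by (simp add: t_def power_divide dist_sym[of a x] flip: power_mult) (simp add: mult.commute)
      finally show ?thesis using True by (simp add: e)
    qed (simp add: coord_def e)
  qed
  show ?thesis
  proof (rule summableI_nonneg_bounded)
    fix N
    have inj: "inj_on pair_at {..<N}"
      by (rule inj_on_inverseI[of _ pair_index]) simp
    have "(\<Sum>n<N. (coord x n - coord y n)\<^sup>2) \<le> (\<Sum>n<N. real q ^ 6 * ?w (pair_at n))"
      by (intro sum_mono bound)
    also have "\<dots> = real q ^ 6 * (\<Sum>e\<in>pair_at ` {..<N}. ?w e)"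
      by (simp only: sum_distrib_left[symmetric] sum.reindex[OF inj] comp_def)
    also have "\<dots> \<le> real q ^ 6 * ((real q + 1) / (1 - (real q + 1) * t))"
      using edge_sum_bounded[OF t, of "pair_at ` {..<N}" x] by (intro mult_left_mono) auto
    finally show "(\<Sum>n<N. (coord x n - coord y n)\<^sup>2) \<le> real q ^ 6 * ((real q + 1) / (1 - (real q + 1) * t))" .
  qed simp
qed

text \<open>
  Along a path the differences add up, and square-summability is preserved under sums.
\<close>

lemma coord_summable: "summable (\<lambda>n. (cmod (complex_of_real (coord x n - coord y n)))\<^sup>2)"
proof -
  have "adj\<^sup>*\<^sup>* x y"
    using tree by (auto simp: graph_tree_def graph_connected_def)
  then show ?thesis
  proof (induction rule: rtranclp_induct)
    case base
    then show ?case by simp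
  next
    case (step y z)
    have "summable (\<lambda>n. (cmod (complex_of_real (coord y n - coord z n)))\<^sup>2)"
      using coord_summable_adj[OF step(2)] by (simp only: norm_of_real power2_abs)
    from summable_sq_add[OF step(3) this] show ?case by simp
  qed
qed

text \<open>
  The harmonic measures themselves are not square-summable over the edges; their differences from
  those at a base point are.
\<close>

definition boundary_map :: "'v \<Rightarrow> 'v \<Rightarrow> ell2"
  where "boundary_map x0 x = Abs_ell2 (\<lambda>n. complex_of_real (coord x n - coord x0 n))"

lemma nth_boundary_map: "ell2_nth (boundary_map x0 x) n = complex_of_real (coord x n - coord x0 n)"
  using coord_summable by (simp add: boundary_map_def Abs_ell2_inverse)

lemma boundary_map_harmonic: "harmonic q adj (boundary_map x0)"
proof -
  have "laplace q adj (boundary_map x0) x = 0" for x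
  proof (rule ell2_eqI)
    fix n
    have "ell2_nth (laplace q adj (boundary_map x0) x) n
        = complex_of_real (nbr_avg (\<lambda>y. coord y n - coord x0 n) x - (coord x n - coord x0 n))"
      by (simp add: laplace_def nbr_avg_def ell2_nth_simps scaleR_scaleC ell2_nth_sum nth_boundary_map)
    then show "ell2_nth (laplace q adj (boundary_map x0) x) n = ell2_nth 0 n"
      by (simp add: nbr_avg_diff coord_harmonic ell2_nth_simps)
  qed
  then show ?thesis by (simp add: harmonic_def)
qed

text \<open>
  Across an edge its own coordinate changes from \<open>1\<close> to \<open>q\<close>.
\<close>

lemma boundary_map_nonconstant: "\<not> (\<exists>c. \<forall>x. boundary_map x0 x = c)"
proof
  assume "\<exists>c. \<forall>x. boundary_map x0 x = c"
  then have const: "boundary_map x0 x = boundary_map x0 y" for x y by metis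
  obtain y where y: "adj x0 y" by (rule third_nbr)
  have "coord y (pair_index (x0, y)) - coord x0 (pair_index (x0, y)) = 0"
    using nth_boundary_map[of x0 y "pair_index (x0, y)"] nth_boundary_map[of x0 x0 "pair_index (x0, y)"]
      const[of y x0] by (metis diff_self of_real_0 of_real_eq_iff)
  then show False
    using q_ge_2 y dist_adj[OF y] dist_adj[OF adj_sym[OF y]] by (simp add: coord_def halftree_measure_def)
qed

end


section \<open>The affine action on differences of harmonic measures\<close>

context boundary_transitive_tree
begin

text \<open>
  The inverse makes the induced operators \<open>v \<mapsto> v \<circ> index_perm g\<close> a left action.
\<close>

definition index_perm :: "('v \<Rightarrow> 'v) \<Rightarrow> nat \<Rightarrow> nat"
  where "index_perm g n = pair_index (map_prod (inv_into UNIV g) (inv_into UNIV g) (pair_at n))"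

lemma G_bij: "g \<in> G \<Longrightarrow> bij g"
  using G_aut by (auto simp: graph_aut_def)

lemma G_inv_right [simp]: "g \<in> G \<Longrightarrow> g (inv_into UNIV g x) = x"
  using G_bij by (simp add: bij_is_surj surj_f_inv_f)

lemma G_inv_left [simp]: "g \<in> G \<Longrightarrow> inv_into UNIV g (g x) = x"
  using G_bij by (simp add: bij_is_inj)

lemma index_perm_eq_iff:
  assumes "g \<in> G"
  shows "index_perm g n = m \<longleftrightarrow> pair_at n = map_prod g g (pair_at m)"
proof
  assume "index_perm g n = m"
  then have "pair_at m = map_prod (inv_into UNIV g) (inv_into UNIV g) (pair_at n)" by (auto simp: index_perm_def)
  then show "pair_at n = map_prod g g (pair_at m)" using assms by (cases "pair_at n") auto
next
  assume "pair_at n = map_prod g g (pair_at m)"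
  then show "index_perm g n = m" using assms by (cases "pair_at m") (simp add: index_perm_def, metis pair_index_at)
qed

lemma bij_index_perm:
  assumes "g \<in> G"
  shows "bij (index_perm g)"
proof (rule bijI)
  show "inj (index_perm g)"
    by (rule injI) (metis pair_index_at index_perm_eq_iff[OF assms])
  show "surj (index_perm g)"
    by (rule surjI[of _ "\<lambda>m. pair_index (map_prod g g (pair_at m))"])
      (simp add: index_perm_eq_iff[OF assms])
qed

lemma index_perm_comp:
  assumes "g \<in> G" "h \<in> G"
  shows "index_perm (g \<circ> h) n = index_perm h (index_perm g n)"
proof -
  have "pair_at n = map_prod g g (pair_at (index_perm g n))"
    using index_perm_eq_iff[OF assms(1)] by blast
  also have "pair_at (index_perm g n) = map_prod h h (pair_at (index_perm h (index_perm g n)))"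
    using index_perm_eq_iff[OF assms(2)] by blast
  finally show ?thesis
    using index_perm_eq_iff[OF G_comp[OF assms]] by (simp add: map_prod.compositionality comp_def)
qed

lemma coord_perm:
  assumes "g \<in> G"
  shows "coord x (index_perm g n) = coord (g x) n"
proof -
  obtain a b where e: "pair_at (index_perm g n) = (a, b)" by (cases "pair_at (index_perm g n)")
  then have "pair_at n = (g a, g b)"
    using index_perm_eq_iff[OF assms, of n "index_perm g n"] by simp
  then show ?thesis
    by (simp add: coord_def e halftree_measure_def G_adj[OF assms] G_dist[OF assms])
qed

definition perm_rep :: "('v \<Rightarrow> 'v) \<Rightarrow> ell2 \<Rightarrow> ell2"
  where "perm_rep g = perm_ell2 (index_perm g)"

lemma nth_perm_rep: "g \<in> G \<Longrightarrow> ell2_nth (perm_rep g v) n = ell2_nth v (index_perm g n)"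
  by (simp add: perm_rep_def nth_perm_ell2 bij_index_perm)

lemma boundary_map_equivariant:
  assumes "g \<in> G"
  shows "boundary_map x0 (g x) = perm_rep g (boundary_map x0 x) + boundary_map x0 (g x0)"
  by (rule ell2_eqI) (simp add: ell2_nth_simps nth_perm_rep nth_boundary_map coord_perm assms)

text \<open>
  A vector is close to one supported on finitely many pairs, and the image of that one depends
  only on where the vertices of these pairs are sent.
\<close>

lemma perm_rep_close:
  assumes "e > 0"
  shows "\<exists>S. finite S \<and> (\<forall>g\<in>G. \<forall>h\<in>G. (\<forall>s\<in>S. h s = g s) \<longrightarrow> dist (perm_rep h v) (perm_rep g v) < e)"
proof -
  have half: "e / 2 > 0" using assms by simp
  obtain N u where Nu: "norm (v - u) < e / 2"
    "\<And>n. ell2_nth u n = (if n < N then ell2_nth v n else 0)"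
    by (rule ell2_tail[OF half, of v]) blast
  define S where "S = fst ` pair_at ` {..<N} \<union> snd ` pair_at ` {..<N}"
  have "dist (perm_rep h v) (perm_rep g v) < e" if gh: "g \<in> G" "h \<in> G" and eq: "\<forall>s\<in>S. h s = g s" for g h
  proof -
    have same: "map_prod h h (pair_at m) = map_prod g g (pair_at m)" if "m < N" for m
      using eq that by (cases "pair_at m") (force simp: S_def)
    have idx: "index_perm g n = m \<longleftrightarrow> index_perm h n = m" if "m < N" for n m
      using same[OF that] by (simp add: index_perm_eq_iff gh)
    have pu: "perm_rep h u = perm_rep g u"
    proof (rule ell2_eqI)
      fix n
      have "index_perm h n = index_perm g n \<or> \<not> index_perm g n < N \<and> \<not> index_perm h n < N"
        using idx[of "index_perm g n" n] idx[of "index_perm h n" n] by metis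
      then show "ell2_nth (perm_rep h u) n = ell2_nth (perm_rep g u) n"
        by (elim disjE) (simp_all add: nth_perm_rep gh Nu(2))
    qed
    have iso: "norm (perm_rep k v - perm_rep k u) = norm (v - u)" if "k \<in> G" for k
      unfolding perm_rep_def by (rule unitary_norm[OF unitary_perm_ell2[OF bij_index_perm[OF that]]])
    have "dist (perm_rep h v) (perm_rep g v)
        \<le> dist (perm_rep h v) (perm_rep h u) + dist (perm_rep g v) (perm_rep g u)"
      using pu dist_triangle2[of "perm_rep h v" "perm_rep g v" "perm_rep h u"] by simp
    also have "\<dots> < e" using iso gh Nu(1) by (simp add: dist_norm)
    finally show ?thesis .
  qed
  moreover have "finite S" by (simp add: S_def)
  ultimately show ?thesis by blast
qed

lemma unitary_perm_rep: "unitary_rep adj G perm_rep"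
  unfolding unitary_rep_def
proof (intro conjI ballI allI)
  fix g assume "g \<in> G"
  then show "unitary_map (perm_rep g)"
    by (simp add: perm_rep_def unitary_perm_ell2 bij_index_perm)
next
  fix g h v assume "g \<in> G" "h \<in> G"
  then show "perm_rep (g \<circ> h) v = perm_rep g (perm_rep h v)"
    by (intro ell2_eqI) (simp add: nth_perm_rep G_comp index_perm_comp)
next
  fix v
  show "continuous_map (subtopology (aut_topology adj) G) euclidean (\<lambda>g. perm_rep g v)"
  proof (rule continuous_map_pointwise)
    fix g and e :: real assume "g \<in> G" "e > 0"
    then show "\<exists>S. finite S \<and> (\<forall>h\<in>G. (\<forall>s\<in>S. h s = g s) \<longrightarrow> dist (perm_rep h v) (perm_rep g v) < e)"
      using perm_rep_close[of e v] by blast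
  qed (use G_aut in blast)
qed

text \<open>
  The cocycle depends on \<open>g\<close> only through \<open>g x0\<close>, hence is locally constant.
\<close>

lemma cocycle_boundary_map: "cocycle adj G perm_rep (\<lambda>g. boundary_map x0 (g x0))"
  unfolding cocycle_def
proof (intro conjI ballI)
  show "continuous_map (subtopology (aut_topology adj) G) euclidean (\<lambda>g. boundary_map x0 (g x0))"
    by (rule continuous_map_pointwise) (use G_aut in \<open>auto intro!: exI[of _ "{x0}"]\<close>)
next
  fix g h assume "g \<in> G" "h \<in> G"
  then show "boundary_map x0 ((g \<circ> h) x0)
      = perm_rep g (boundary_map x0 (h x0)) + boundary_map x0 (g x0)"
    using boundary_map_equivariant[of g x0 "h x0"] by simp
qed

theorem harmonic_equivariant_exists:
  "\<exists>(\<alpha> :: ('v \<Rightarrow> 'v) \<Rightarrow> ell2 \<Rightarrow> ell2) F. affine_isometric_action adj G \<alpha> \<and> equivariant G \<alpha> F \<and>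
    harmonic q adj F \<and> \<not> (\<exists>c. \<forall>x. F x = c)"
proof -
  fix x0 :: 'v
  let ?b = "\<lambda>g. boundary_map x0 (g x0)"
  let ?\<alpha> = "\<lambda>g v. perm_rep g v + ?b g"
  have "affine_isometric_action adj G ?\<alpha>"
    unfolding affine_isometric_action_def using unitary_perm_rep cocycle_boundary_map by blast
  moreover have "equivariant G ?\<alpha> (boundary_map x0)"
    unfolding equivariant_def using boundary_map_equivariant by blast
  ultimately show ?thesis
    using boundary_map_harmonic boundary_map_nonconstant by blast
qed

end


section \<open>Equivariant and harmonic maps into Hilbert spaces\<close>

theorem theorem1p2:
  fixes q :: nat
    and adj :: "'v \<Rightarrow> 'v \<Rightarrow> bool"
    and G :: "('v \<Rightarrow> 'v) set"
  assumes "q \<ge> 2"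
    and "regular_tree (q + 1) adj"
    and "subgroup G (aut_group adj)"
    and "closedin (aut_topology adj) G"
    and "\<not> compactin (aut_topology adj) G"
    and "vertex_transitive G"
    and "boundary_transitive adj G"
  shows
    "(\<forall>(\<alpha> :: ('v \<Rightarrow> 'v) \<Rightarrow> 'h \<Rightarrow> 'h::complex_hilbert_space) F x0 x1.
        affine_isometric_action adj G \<alpha> \<and> equivariant G \<alpha> F \<and> F x0 = 0 \<and> adj x0 x1 \<longrightarrow>
        (let A = (real q + 1) * (norm (F x1))\<^sup>2 / (real q - 1);
             B = 2 * real q * (norm (F x1))\<^sup>2 / (real q - 1)\<^sup>2
         in \<forall>x. (norm (F x))\<^sup>2 \<le> A * real (graph_dist adj x x0) - B
                  + B * real q powi (- int (graph_dist adj x x0))))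
     \<and>
     (\<forall>(\<alpha> :: ('v \<Rightarrow> 'v) \<Rightarrow> 'h \<Rightarrow> 'h) F x0 x1.
        affine_isometric_action adj G \<alpha> \<and> equivariant G \<alpha> F \<and> F x0 = 0 \<and> adj x0 x1 \<and>
        harmonic q adj F \<and> \<not> (\<exists>c. \<forall>x. F x = c) \<longrightarrow>
        (let A = (real q + 1) * (norm (F x1))\<^sup>2 / (real q - 1);
             B = 2 * real q * (norm (F x1))\<^sup>2 / (real q - 1)\<^sup>2
         in \<forall>x. (norm (F x))\<^sup>2 = A * real (graph_dist adj x x0) - B
                  + B * real q powi (- int (graph_dist adj x x0))))
     \<and>
     (\<exists>(\<alpha> :: ('v \<Rightarrow> 'v) \<Rightarrow> ell2 \<Rightarrow> ell2) F.
        affine_isometric_action adj G \<alpha> \<and> equivariant G \<alpha> F \<and>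
        harmonic q adj F \<and> \<not> (\<exists>c. \<forall>x. F x = c))"
proof -
  interpret boundary_transitive_tree adj q G
    by (intro boundary_transitive_tree.intro boundary_transitive_tree_axioms.intro
        regular_tree_graph.intro regular_tree_graph_axioms.intro tree_graph.intro)
      (use assms in \<open>auto simp: regular_tree_def\<close>)
  show ?thesis
    unfolding Let_def
    by (intro conjI allI impI harmonic_equivariant_exists; elim conjE;
      rule equivariant_norm_bound; assumption)
qed

end
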